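(* Let $X\subset\mathbb{C}^n$ be a domain with the uniform squeezing property, i.e. there is a constant $c_0>0$ such that $S_X(z)>c_0$ for all $z\in X$. Then $X$ is both $c$-uniformly thick and $k$-uniformly thick.
   Context: $\mathbb{D}$ is the open unit disk in $\mathbb{C}$, and $\mathbb{B}^n$ is the open Euclidean unit ball in $\mathbb{C}^n$. $\rho_{\mathbb{D}}$ is the Poincaré distance on $\mathbb{D}$ with density $\frac{2}{1-|z|^2}$. For a complex manifold $X$: - The Carathéodory pseudo-distance is $c_X(z_1,z_2)=\sup\{\rho_{\mathbb{D}}(f(z_1),f(z_2)) : f:X\to\mathbb{D}\text{ holomorphic}\}$. - The Kobayashi pseudo-distance is $k_X(z_1,z_2)=\inf \sum_{i=1}^m\rho_{\mathbb{D}}(a_i,b_i)$, the infimum over all $m\ge1$, $a_i,b_i\in\mathbb{D}$ and holomorphic $f_i:\mathbb{D}\to X$ with $f_1(a_1)=z_1$, $f_i(b_i)=f_{i+1}(a_{i+1})$ for $1\le i<m$, and $f_m(b_m)=z_2$. For $d=k$ or $c$, $X$ is $d$-hyperbolic if $d_X$ is a distance, and $B^d_X(z;r)=\{w\in X: d_X(z,w)<r\}$. The squeezing function of a domain $X\subset\mathbb{C}^n$ is $$S_X(z)=\sup\{\tanh\tfrac r2 : r>0,\ B^k_{\mathbb{B}^n}(f(z);r)\subset f(X)\text{ for some injective holomorphic } f:X\to\mathbb{B}^n\},$$ with the supremum of the empty set equal to $0$. The Fridman function is $$H^d_X(z)=\sup\{\tanh\tfrac r2 : r>0,\ B^d_X(z;r)\subset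 f(\mathbb{B}^n)\text{ for some injective holomorphic } f:\mathbb{B}^n\to X\}.$$ For $d=k$ or $c$, a complex manifold $X$ of dimension $n$ is $d$-uniformly thick if it is $d$-hyperbolic and $H^d_X$ has a positive lower bound on $X$. *)

theory Defs
  imports "HOL-Complex_Analysis.Complex_Analysis"
begin

text \<open>
  \<open>\<complex>\<^sup>n\<close> is \<^typ>\<open>complex ^ 'n\<close>, whose norm is the Euclidean one; hence the unit disc and
  the unit ball are both \<open>ball 0 1\<close>. Complex scalar multiplication of vectors is \<open>*s\<close>.
\<close>

abbreviation unit_disc :: "complex set" where
  "unit_disc \<equiv> ball 0 1"

abbreviation unit_ball :: "(complex ^ 'n) set" where
  "unit_ball \<equiv> ball 0 1"

text \<open>
  Holomorphy on an open subset of \<open>\<complex>\<^sup>n\<close>: the Frechet derivative exists everywhere and is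
  \<open>\<complex>\<close>-linear (\<open>has_derivative\<close> already provides additivity).
\<close>

definition holomorphic_fun :: "(complex ^ 'n \<Rightarrow> complex) \<Rightarrow> (complex ^ 'n) set \<Rightarrow> bool" where
  "holomorphic_fun f S \<longleftrightarrow>
     (\<forall>x\<in>S. \<exists>f'. (f has_derivative f') (at x within S) \<and> (\<forall>c v. f' (c *s v) = c * f' v))"

definition holomorphic_map :: "(complex ^ 'n \<Rightarrow> complex ^ 'm) \<Rightarrow> (complex ^ 'n) set \<Rightarrow> bool" where
  "holomorphic_map f S \<longleftrightarrow> (\<forall>i. holomorphic_fun (\<lambda>x. f x $ i) S)"

definition holomorphic_curve :: "(complex \<Rightarrow> complex ^ 'n) \<Rightarrow> complex set \<Rightarrow> bool" where
  "holomorphic_curve f S \<longleftrightarrow> (\<forall>i. (\<lambda>x. f x $ i) holomorphic_on S)"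

text \<open>
  A \<open>valid_path\<close> may have infinite length, in which case \<open>integral\<close> would return an
  arbitrary value; \<open>has_integral\<close> restricts the infimum to the paths of finite length.
\<close>

definition poincare_dist :: "complex \<Rightarrow> complex \<Rightarrow> real" where
  "poincare_dist a b = Inf {L. \<exists>\<gamma>. valid_path \<gamma> \<and> path_image \<gamma> \<subseteq> unit_disc \<and>
     pathstart \<gamma> = a \<and> pathfinish \<gamma> = b \<and>
     ((\<lambda>t. 2 / (1 - (cmod (\<gamma> t))\<^sup>2) * cmod (vector_derivative \<gamma> (at t within {0..1})))
        has_integral L) {0..1}}"

text \<open>
  The pseudo-distances take values in the extended reals, so that no boundedness or
  nonemptiness condition is needed for the supremum and the infimum to be meaningful.
\<close>

definition caratheodory_dist ::
    "(complex ^ 'n) set \<Rightarrow> complex ^ 'n \<Rightarrow> complex ^ 'n \<Rightarrow> ereal" where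
  "caratheodory_dist X z w =
     Sup {ereal (poincare_dist (f z) (f w)) |f. holomorphic_fun f X \<and> f ` X \<subseteq> unit_disc}"

definition kobayashi_dist ::
    "(complex ^ 'n) set \<Rightarrow> complex ^ 'n \<Rightarrow> complex ^ 'n \<Rightarrow> ereal" where
  "kobayashi_dist X z w =
     Inf {ereal (\<Sum>i=1..m. poincare_dist (a i) (b i)) |m a b f.
       1 \<le> m \<and>
       (\<forall>i\<in>{1..m}. a i \<in> unit_disc \<and> b i \<in> unit_disc \<and>
          holomorphic_curve (f i) unit_disc \<and> f i ` unit_disc \<subseteq> X) \<and>
       f 1 (a 1) = z \<and>
       (\<forall>i\<in>{1..<m}. f i (b i) = f (Suc i) (a (Suc i))) \<and>
       f m (b m) = w}"

text \<open>
  Below, \<open>d\<close> assigns to each \<open>X\<close> the pseudo-distance \<open>d\<^sub>X\<close>.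
  The locale \<open>Metric_space\<close> also constrains its distance outside the carrier, hence the
  extension by \<open>0\<close>.
\<close>

definition hyperbolic ::
    "((complex ^ 'n) set \<Rightarrow> complex ^ 'n \<Rightarrow> complex ^ 'n \<Rightarrow> ereal) \<Rightarrow> (complex ^ 'n) set \<Rightarrow> bool"
  where
  "hyperbolic d X \<longleftrightarrow>
     (\<forall>z\<in>X. \<forall>w\<in>X. \<bar>d X z w\<bar> \<noteq> \<infinity>) \<and>
     Metric_space X (\<lambda>z w. if z \<in> X \<and> w \<in> X then real_of_ereal (d X z w) else 0)"

definition dist_ball ::
    "((complex ^ 'n) set \<Rightarrow> complex ^ 'n \<Rightarrow> complex ^ 'n \<Rightarrow> ereal) \<Rightarrow>
     (complex ^ 'n) set \<Rightarrow> complex ^ 'n \<Rightarrow> real \<Rightarrow> (complex ^ 'n) set" where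
  "dist_ball d X z r = {w \<in> X. d X z w < ereal r}"

text \<open>
  Inserting \<open>0\<close> implements the convention \<open>sup \<emptyset> = 0\<close>; it does not affect nonempty sets, since
  all the values \<open>tanh (r / 2)\<close> are positive. They are also bounded by \<open>1\<close>.
\<close>

definition squeezing_fun :: "(complex ^ 'n) set \<Rightarrow> complex ^ 'n \<Rightarrow> real" where
  "squeezing_fun X z = Sup (insert 0 {tanh (r / 2) |r. r > 0 \<and>
     (\<exists>f :: complex ^ 'n \<Rightarrow> complex ^ 'n.
        holomorphic_map f X \<and> inj_on f X \<and> f ` X \<subseteq> unit_ball \<and>
        dist_ball kobayashi_dist unit_ball (f z) r \<subseteq> f ` X)})"

definition fridman_fun ::
    "((complex ^ 'n) set \<Rightarrow> complex ^ 'n \<Rightarrow> complex ^ 'n \<Rightarrow> ereal) \<Rightarrow>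
     (complex ^ 'n) set \<Rightarrow> complex ^ 'n \<Rightarrow> real" where
  "fridman_fun d X z = Sup (insert 0 {tanh (r / 2) |r. r > 0 \<and>
     (\<exists>f :: complex ^ 'n \<Rightarrow> complex ^ 'n.
        holomorphic_map f unit_ball \<and> inj_on f unit_ball \<and> f ` unit_ball \<subseteq> X \<and>
        dist_ball d X z r \<subseteq> f ` unit_ball)})"

definition uniformly_thick ::
    "((complex ^ 'n) set \<Rightarrow> complex ^ 'n \<Rightarrow> complex ^ 'n \<Rightarrow> ereal) \<Rightarrow> (complex ^ 'n) set \<Rightarrow> bool"
  where
  "uniformly_thick d X \<longleftrightarrow> hyperbolic d X \<and> (\<exists>\<epsilon>>0. \<forall>z\<in>X. \<epsilon> \<le> fridman_fun d X z)"

end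

theory Submission
  imports Defs
begin

text \<open>
  Let \<open>f : X \<rightarrow> B\<close> be an injective holomorphic map into the unit ball whose image contains the
  Kobayashi ball of radius \<open>r\<close> about \<open>p = f z\<close>. That ball contains an ellipsoid centred at \<open>p\<close>, the
  image of \<open>B\<close> under an affine map \<open>E\<close>, and \<open>f\<^sup>-\<^sup>1 \<circ> E\<close> embeds \<open>B\<close> into \<open>X\<close>. The components of the
  automorphism of \<open>B\<close> sending \<open>p\<close> to \<open>0\<close>, composed with \<open>f\<close>, are competitors for the Caratheodory
  distance of \<open>X\<close>; hence a Caratheodory ball about \<open>z\<close>, of radius depending only on \<open>r\<close> and \<open>n\<close>, is
  mapped by \<open>f\<close> into the ellipsoid. The Kobayashi ball is smaller, by the Schwarz--Pick lemma.

  The map \<open>h = f\<^sup>-\<^sup>1\<close> is continuous by invariance of domain, and holomorphic off the zeros of the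
  continuous function \<open>u = det f' \<circ> h\<close>. On a complex line where \<open>u\<close> does not vanish identically, an
  extension of Rado's theorem shows that \<open>h\<close> is holomorphic. By Sard's theorem such lines are dense,
  so \<open>h\<close> is holomorphic on the remaining lines as a uniform limit, and Osgood's lemma applies.
\<close>

section \<open>The Poincare distance\<close>

text \<open>The obstacle is uniformity. As \<open>p\<close> approaches the sphere, a Euclidean ball
  about \<open>p\<close> of fixed invariant size does not exist; the ellipsoid instead has semi-axes
  proportional to 1 - |p|^2 along \<open>p\<close> and to the square root of this across it, and the
  automorphism undoes exactly this distortion. Hence the final constants depend on the squeezing
  bound and the dimension only. Competitors for the Caratheodory distance are scalar-valued, so the
  automorphism is measured one component at a time; adding up the components costs the factor
  \<open>CARD('n')\<close> in the radius. Crude bounds on the Poincare distance are enough: one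
  affine disc through \<open>p\<close> bounds the Kobayashi distance in the ball from above, and the
  density being at least 2 bounds the Caratheodory distance of X from below. The inverse must be
  shown holomorphic because the Fridman function asks for holomorphic embeddings into X. That the
  Jacobian of an injective map has no zeros is a deep fact in several variables; treating its zeros
  as a removable set in the sense of Rado goes around it.\<close>

definition hyp_length :: "(real \<Rightarrow> complex) \<Rightarrow> real \<Rightarrow> bool" where
  "hyp_length \<gamma> L \<longleftrightarrow>
     ((\<lambda>t. 2 / (1 - (cmod (\<gamma> t))\<^sup>2) * cmod (vector_derivative \<gamma> (at t within {0..1})))
        has_integral L) {0..1}"

lemma poincare_dist_eq:
  "poincare_dist a b = Inf {L. \<exists>\<gamma>. valid_path \<gamma> \<and> path_image \<gamma> \<subseteq> unit_disc \<and>
     pathstart \<gamma> = a \<and> pathfinish \<gamma> = b \<and> hyp_length \<gamma> L}"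
  by (simp add: poincare_dist_def hyp_length_def)

text \<open>A piecewise C1 path may fail to be differentiable at finitely many parameters, where
  \<open>vector_derivative\<close> has no meaning. The integral ignores finite sets, so a derivative
  formula off such a set determines the length.\<close>

lemma hyp_length_cong:
  assumes "finite S" "\<And>t. t \<in> {0..1} - S \<Longrightarrow> (\<gamma> has_vector_derivative g t) (at t)"
  shows "hyp_length \<gamma> L \<longleftrightarrow> ((\<lambda>t. 2 / (1 - (cmod (\<gamma> t))\<^sup>2) * cmod (g t)) has_integral L) {0..1}"
  unfolding hyp_length_def
  by (rule has_integral_spike_finite_eq[OF assms(1)])
     (auto simp: vector_derivative_at_within_ivl[OF assms(2)])

lemma valid_path_derivative:
  fixes \<gamma> :: "real \<Rightarrow> complex"
  assumes "valid_path \<gamma>"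
  obtains S where "finite S"
    "\<And>t. t \<in> {0..1} - S \<Longrightarrow> (\<gamma> has_vector_derivative vector_derivative \<gamma> (at t)) (at t)"
    "continuous_on ({0..1} - S) (\<lambda>t. vector_derivative \<gamma> (at t))"
  using assms
  by (auto simp: valid_path_def piecewise_C1_differentiable_on_def C1_differentiable_on_eq
      vector_derivative_works)

lemma in_path_image: "0 \<le> t \<Longrightarrow> t \<le> 1 \<Longrightarrow> \<gamma> t \<in> path_image \<gamma>"
  by (auto simp: path_image_def)

text \<open>The density is at least 2 throughout the disc, so the hyperbolic length dominates twice
  the Euclidean length, hence twice the chord.\<close>

lemma hyp_length_lower:
  assumes "valid_path \<gamma>" "path_image \<gamma> \<subseteq> unit_disc" "hyp_length \<gamma> L"
  shows "2 * cmod (pathfinish \<gamma> - pathstart \<gamma>) \<le> L"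
proof -
  obtain S where S: "finite S"
    "\<And>t. t \<in> {0..1} - S \<Longrightarrow> (\<gamma> has_vector_derivative vector_derivative \<gamma> (at t)) (at t)"
    using valid_path_derivative[OF assms(1)] by metis
  let ?g = "\<lambda>t. vector_derivative \<gamma> (at t)"
  have L: "((\<lambda>t. 2 / (1 - (cmod (\<gamma> t))\<^sup>2) * cmod (?g t)) has_integral L) {0..1}"
    using hyp_length_cong[OF S] assms(3) by blast
  have "continuous_on {0..1} \<gamma>"
    using assms(1) by (simp add: valid_path_def piecewise_C1_differentiable_on_def)
  then have D: "(?g has_integral (\<gamma> 1 - \<gamma> 0)) {0..1}"
    by (intro fundamental_theorem_of_calculus_strong[OF S(1)]) (use S in auto)
  have "norm (integral {0..1} (\<lambda>t. 2 *\<^sub>R ?g t)) \<le>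
      integral {0..1} (\<lambda>t. 2 / (1 - (cmod (\<gamma> t))\<^sup>2) * cmod (?g t))"
  proof (rule Henstock_Kurzweil_Integration.integral_norm_bound_integral)
    show "(\<lambda>t. 2 *\<^sub>R ?g t) integrable_on {0..1}"
      using has_integral_cmul[OF D] by (auto simp: integrable_on_def)
    fix t :: real assume "t \<in> {0..1}"
    then have "cmod (\<gamma> t) < 1"
      using assms(2) in_path_image[of t \<gamma>] by auto
    then have "(cmod (\<gamma> t))\<^sup>2 < 1"
      by (simp add: power_less_one_iff)
    then have "2 \<le> 2 / (1 - (cmod (\<gamma> t))\<^sup>2)"
      by (simp add: field_simps)
    from mult_right_mono[OF this norm_ge_zero[of "?g t"]]
    show "norm (2 *\<^sub>R ?g t) \<le> 2 / (1 - (cmod (\<gamma> t))\<^sup>2) * cmod (?g t)"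
      by simp
  qed (use L in auto)
  then show ?thesis
    using integral_unique[OF has_integral_cmul[OF D, of 2]] integral_unique[OF L]
    by (simp add: pathstart_def pathfinish_def)
qed

lemma hyp_length_reversepath:
  assumes "valid_path \<gamma>" "hyp_length \<gamma> L"
  shows "hyp_length (reversepath \<gamma>) L"
proof -
  obtain S where S: "finite S"
    "\<And>t. t \<in> {0..1} - S \<Longrightarrow> (\<gamma> has_vector_derivative vector_derivative \<gamma> (at t)) (at t)"
    using valid_path_derivative[OF assms(1)] by metis
  let ?g = "\<lambda>t. vector_derivative \<gamma> (at t)"
  have L: "((\<lambda>t. 2 / (1 - (cmod (\<gamma> t))\<^sup>2) * cmod (?g t)) has_integral L) {0..1}"
    using hyp_length_cong[OF S] assms(2) by blast
  have "((\<lambda>t. 2 / (1 - (cmod (\<gamma> (1 - t)))\<^sup>2) * cmod (?g (1 - t))) has_integral L) {0..1}"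
    using has_integral_affinity01[OF L, where m = "-1" and c = 1] by simp
  moreover have "(reversepath \<gamma> has_vector_derivative (- ?g (1 - t))) (at t)"
    if "t \<in> {0..1} - (\<lambda>t. 1 - t) ` S" for t
  proof -
    have "1 - t \<in> {0..1} - S"
      using that by (force simp: image_iff)
    then have "(\<gamma> \<circ> (\<lambda>t. 1 - t) has_vector_derivative (-1) *\<^sub>R ?g (1 - t)) (at t)"
      by (intro vector_diff_chain_at) (use S in \<open>auto intro!: derivative_eq_intros\<close>)
    then show ?thesis
      by (simp add: reversepath_def o_def)
  qed
  ultimately show ?thesis
    using hyp_length_cong[of "(\<lambda>t. 1 - t) ` S" "reversepath \<gamma>" "\<lambda>t. - ?g (1 - t)" L] S(1)
    by (simp add: reversepath_def)
qed

lemma hyp_length_join: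
  assumes "valid_path \<gamma>1" "hyp_length \<gamma>1 L1" "valid_path \<gamma>2" "hyp_length \<gamma>2 L2"
  shows "hyp_length (\<gamma>1 +++ \<gamma>2) (L1 + L2)"
proof -
  obtain S1 where S1: "finite S1"
    "\<And>t. t \<in> {0..1} - S1 \<Longrightarrow> (\<gamma>1 has_vector_derivative vector_derivative \<gamma>1 (at t)) (at t)"
    using valid_path_derivative[OF assms(1)] by metis
  obtain S2 where S2: "finite S2"
    "\<And>t. t \<in> {0..1} - S2 \<Longrightarrow> (\<gamma>2 has_vector_derivative vector_derivative \<gamma>2 (at t)) (at t)"
    using valid_path_derivative[OF assms(3)] by metis
  let ?g1 = "\<lambda>t. vector_derivative \<gamma>1 (at t)" and ?g2 = "\<lambda>t. vector_derivative \<gamma>2 (at t)"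
  let ?d = "\<lambda>z. 2 / (1 - (cmod z)\<^sup>2)"
  define g where "g t = (if t \<le> 1/2 then 2 *\<^sub>R ?g1 (2 * t) else 2 *\<^sub>R ?g2 (2 * t - 1))" for t
  have L1: "((\<lambda>t. ?d (\<gamma>1 t) * cmod (?g1 t)) has_integral L1) {0..1}"
    using hyp_length_cong[OF S1] assms(2) by blast
  have L2: "((\<lambda>t. ?d (\<gamma>2 t) * cmod (?g2 t)) has_integral L2) {0..1}"
    using hyp_length_cong[OF S2] assms(4) by blast
  have 1: "((\<lambda>t. ?d (\<gamma>1 (2 * t)) * cmod (2 *\<^sub>R ?g1 (2 * t))) has_integral L1) {0..1/2}"
    using has_integral_affinity01[OF L1, where m = 2 and c = 0, THEN has_integral_cmul[where c = 2]]
    by (simp only: image_affinity_atLeastAtMost_div_diff) (simp add: mult_ac)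
  have 2: "((\<lambda>t. ?d (\<gamma>2 (2 * t - 1)) * cmod (2 *\<^sub>R ?g2 (2 * t - 1))) has_integral L2) {1/2..1}"
    using has_integral_affinity01[OF L2, where m = 2 and c = "-1", THEN has_integral_cmul[where c = 2]]
    by (simp only: image_affinity_atLeastAtMost_div_diff) (simp add: mult_ac)
  have 1: "((\<lambda>t. ?d ((\<gamma>1 +++ \<gamma>2) t) * cmod (g t)) has_integral L1) {0..1/2}"
    by (rule has_integral_eq[OF _ 1]) (auto simp: joinpaths_def g_def)
  \<comment> \<open>At the junction \<open>g\<close> takes the value of the first branch, so the
    second formula fails at the single point 1/2.\<close>
  have 2: "((\<lambda>t. ?d ((\<gamma>1 +++ \<gamma>2) t) * cmod (g t)) has_integral L2) {1/2..1}"
    by (rule has_integral_spike_finite[OF _ _ 2, of "{1/2}"]) (auto simp: joinpaths_def g_def)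
  have "((\<lambda>t. ?d ((\<gamma>1 +++ \<gamma>2) t) * cmod (g t)) has_integral (L1 + L2)) {0..1}"
    by (rule Henstock_Kurzweil_Integration.has_integral_combine[OF _ _ 1 2]) auto
  moreover have "((\<gamma>1 +++ \<gamma>2) has_vector_derivative g t) (at t)"
    if "t \<in> {0..1} - ({1/2} \<union> (\<lambda>t. t / 2) ` S1 \<union> (\<lambda>t. (t + 1) / 2) ` S2)" for t
  proof (cases "t < 1/2")
    case True
    have "2 * t \<notin> S1"
    proof
      assume "2 * t \<in> S1"
      then have "2 * t / 2 \<in> (\<lambda>t. t / 2) ` S1"
        by (rule imageI)
      with that show False
        by simp
    qed
    then have "2 * t \<in> {0..1} - S1"
      using that True by auto
    then have "(\<gamma>1 \<circ> (\<lambda>t. 2 * t) has_vector_derivative 2 *\<^sub>R ?g1 (2 * t)) (at t)"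
      by (intro vector_diff_chain_at S1(2))
         (auto intro!: derivative_eq_intros simp flip: has_real_derivative_iff_has_vector_derivative)
    then have "((\<gamma>1 +++ \<gamma>2) has_vector_derivative 2 *\<^sub>R ?g1 (2 * t)) (at t)"
      by (rule has_vector_derivative_transform_within_open[of _ _ _ "{..<1/2}"])
         (use True in \<open>auto simp: joinpaths_def\<close>)
    then show ?thesis
      using True by (simp add: g_def)
  next
    case False
    then have t: "t > 1/2"
      using that by auto
    have "2 * t - 1 \<notin> S2"
    proof
      assume "2 * t - 1 \<in> S2"
      then have "(2 * t - 1 + 1) / 2 \<in> (\<lambda>t. (t + 1) / 2) ` S2"
        by (rule imageI)
      with that show False
        by simp
    qed
    then have "2 * t - 1 \<in> {0..1} - S2"
      using that t by auto
    then have "(\<gamma>2 \<circ> (\<lambda>t. 2 * t - 1) has_vector_derivative 2 *\<^sub>R ?g2 (2 * t - 1)) (at t)"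
      by (intro vector_diff_chain_at S2(2))
         (auto intro!: derivative_eq_intros simp flip: has_real_derivative_iff_has_vector_derivative)
    then have "((\<gamma>1 +++ \<gamma>2) has_vector_derivative 2 *\<^sub>R ?g2 (2 * t - 1)) (at t)"
      by (rule has_vector_derivative_transform_within_open[of _ _ _ "{1/2<..}"])
         (use t in \<open>auto simp: joinpaths_def\<close>)
    then show ?thesis
      using t by (simp add: g_def)
  qed
  ultimately show ?thesis
    using hyp_length_cong[of "{1/2} \<union> (\<lambda>t. t / 2) ` S1 \<union> (\<lambda>t. (t + 1) / 2) ` S2" "\<gamma>1 +++ \<gamma>2" g "L1 + L2"]
      S1(1) S2(1) by auto
qed

text \<open>Moebius maps carrying 0 to \<open>a\<close> and \<open>f a\<close> to 0 turn
  \<open>f\<close> into a self-map \<open>G\<close> fixing 0, to which the Schwarz lemma applies.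
  Their derivatives 1 - |a|^2 and 1 / (1 - |f a|^2) are the factors in the inequality.\<close>

lemma Schwarz_Pick_deriv:
  assumes f: "f holomorphic_on unit_disc" "f ` unit_disc \<subseteq> unit_disc" and a: "a \<in> unit_disc"
  shows "cmod (deriv f a) * (1 - (cmod a)\<^sup>2) \<le> 1 - (cmod (f a))\<^sup>2"
proof -
  let ?b = "f a"
  have na: "cmod a < 1" and nb: "cmod ?b < 1"
    using a f(2) by (auto simp: image_subset_iff)
  define G where "G = Moebius_function 0 ?b \<circ> f \<circ> Moebius_function 0 (-a)"
  have ma: "Moebius_function 0 (-a) ` unit_disc \<subseteq> unit_disc"
    using Moebius_function_norm_lt_1[of "-a"] na by auto
  have "G holomorphic_on unit_disc"
    unfolding G_def using na nb f ma
    by (intro holomorphic_on_compose_gen[of _ _ _ unit_disc] Moebius_function_holomorphic) auto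
  moreover have M0: "Moebius_function 0 (-a) 0 = a"
    by (simp add: Moebius_function_simple)
  moreover have "G 0 = 0"
    by (simp add: G_def M0 Moebius_function_eq_zero)
  moreover have "cmod (G z) < 1" if "cmod z < 1" for z
    unfolding G_def o_def using that nb f(2) ma
    by (intro Moebius_function_norm_lt_1) (auto simp: subset_eq)
  ultimately have le: "cmod (deriv G 0) \<le> 1"
    using Schwarz_Lemma(2)[of G 0] by auto
  have 1: "1 - a * cnj a = of_real (1 - (cmod a)\<^sup>2)" "1 - cnj ?b * ?b = of_real (1 - (cmod ?b)\<^sup>2)"
    using complex_norm_square[of a] complex_norm_square[of ?b] by (simp_all add: mult.commute)
  have pos: "1 - (cmod a)\<^sup>2 > 0" "1 - (cmod ?b)\<^sup>2 > 0"
    using na nb by (simp_all add: power_less_one_iff)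
  have d1: "(Moebius_function 0 (-a) has_field_derivative of_real (1 - (cmod a)\<^sup>2)) (at 0)"
  proof -
    have "((\<lambda>z. (z + a) / (1 + cnj a * z)) has_field_derivative (1 - a * cnj a)) (at 0)"
      by (auto intro!: derivative_eq_intros)
    then show ?thesis
      unfolding 1 by (simp add: Moebius_function_simple[abs_def])
  qed
  have d2: "(Moebius_function 0 ?b has_field_derivative 1 / of_real (1 - (cmod ?b)\<^sup>2)) (at ?b)"
  proof -
    have nz: "1 - cnj ?b * ?b \<noteq> 0"
      unfolding 1 of_real_eq_0_iff using pos by auto
    have "((\<lambda>z. (z - ?b) / (1 - cnj ?b * z)) has_field_derivative 1 / (1 - cnj ?b * ?b)) (at ?b)"
      by (rule derivative_eq_intros refl nz | use nz in simp)+
    then show ?thesis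
      unfolding 1 by (simp add: Moebius_function_simple[abs_def])
  qed
  have df: "(f has_field_derivative deriv f a) (at a)"
    using f(1) a holomorphic_derivI[of f unit_disc] by auto
  have "(G has_field_derivative 1 / of_real (1 - (cmod ?b)\<^sup>2) * (deriv f a * of_real (1 - (cmod a)\<^sup>2))) (at 0)"
    unfolding G_def o_assoc[symmetric]
    by (intro DERIV_chain d1) (unfold o_def M0, rule d2, rule df)
  then have "deriv G 0 = 1 / of_real (1 - (cmod ?b)\<^sup>2) * (deriv f a * of_real (1 - (cmod a)\<^sup>2))"
    by (rule DERIV_imp_deriv)
  then have "cmod (deriv G 0) = cmod (deriv f a) * (1 - (cmod a)\<^sup>2) / (1 - (cmod ?b)\<^sup>2)"
    using pos by (simp add: norm_mult norm_divide del: of_real_diff of_real_power)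
  then have "cmod (deriv f a) * (1 - (cmod a)\<^sup>2) / (1 - (cmod ?b)\<^sup>2) \<le> 1"
    using le by simp
  then show ?thesis
    using pos(2) by (simp only: divide_le_eq_1_pos)
qed

text \<open>Pointwise the new integrand is at most the old one by the infinitesimal Schwarz-Pick
  inequality. The existence of the new length is part of the claim, since infinite lengths are
  excluded by \<open>has_integral\<close>.\<close>

lemma hyp_length_compose:
  assumes f: "f holomorphic_on unit_disc" "f ` unit_disc \<subseteq> unit_disc"
    and \<gamma>: "valid_path \<gamma>" "path_image \<gamma> \<subseteq> unit_disc" "hyp_length \<gamma> L"
  obtains L' where "L' \<le> L" "hyp_length (f \<circ> \<gamma>) L'"
proof -
  obtain S where S: "finite S"
    "\<And>t. t \<in> {0..1} - S \<Longrightarrow> (\<gamma> has_vector_derivative vector_derivative \<gamma> (at t)) (at t)"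
    and cS: "continuous_on ({0..1} - S) (\<lambda>t. vector_derivative \<gamma> (at t))"
    using valid_path_derivative[OF \<gamma>(1)] by metis
  let ?g = "\<lambda>t. vector_derivative \<gamma> (at t)" and ?d = "\<lambda>z. 2 / (1 - (cmod z)\<^sup>2)"
  let ?h = "\<lambda>t. ?g t * deriv f (\<gamma> t)"
  have L: "((\<lambda>t. ?d (\<gamma> t) * cmod (?g t)) has_integral L) {0..1}"
    using hyp_length_cong[OF S] \<gamma>(3) by blast
  have in_disc: "\<gamma> t \<in> unit_disc" if "t \<in> {0..1}" for t
    using that \<gamma>(2) in_path_image[of t \<gamma>] by auto
  have der: "((f \<circ> \<gamma>) has_vector_derivative ?h t) (at t)" if "t \<in> {0..1} - S" for t
    by (rule field_vector_diff_chain_at[OF S(2)])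
       (use that in_disc[of t] f(1) holomorphic_derivI[of f unit_disc] in auto)
  have c\<gamma>: "continuous_on {0..1} \<gamma>"
    using \<gamma>(1) by (simp add: valid_path_def piecewise_C1_differentiable_on_def)
  have c1: "continuous_on {0..1} (\<lambda>t. f (\<gamma> t))"
    by (rule continuous_on_compose2[OF holomorphic_on_imp_continuous_on[OF f(1)] c\<gamma>])
       (use in_disc in auto)
  have c2: "continuous_on {0..1} (\<lambda>t. deriv f (\<gamma> t))"
    by (rule continuous_on_compose2[OF holomorphic_on_imp_continuous_on[OF holomorphic_deriv[OF f(1)]] c\<gamma>])
       (use in_disc in auto)
  have lt: "(cmod (f (\<gamma> t)))\<^sup>2 < 1" "(cmod (\<gamma> t))\<^sup>2 < 1" if "t \<in> {0..1}" for t
    using in_disc[OF that] f(2) by (auto simp: power_less_one_iff subset_eq)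
  have le: "?d (f (\<gamma> t)) * cmod (?h t) \<le> ?d (\<gamma> t) * cmod (?g t)" if t: "t \<in> {0..1}" for t
  proof -
    have "?d (f (\<gamma> t)) * cmod (deriv f (\<gamma> t)) \<le> ?d (\<gamma> t)"
      using Schwarz_Pick_deriv[OF f in_disc[OF t]] lt[OF t] by (simp add: field_simps)
    then have "?d (f (\<gamma> t)) * cmod (deriv f (\<gamma> t)) * cmod (?g t) \<le> ?d (\<gamma> t) * cmod (?g t)"
      by (rule mult_right_mono) simp
    then show ?thesis
      using lt[OF t] by (simp add: norm_mult mult_ac)
  qed
  \<comment> \<open>The speed may be unbounded near the points of \<open>S\<close>, so continuity
    off \<open>S\<close> yields only measurability; integrability comes from domination by the
    integrand of \<open>\<gamma>\<close>.\<close>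
  have "(\<lambda>t. ?d (f (\<gamma> t)) * cmod (?h t)) integrable_on ({0..1} - S)"
  proof (rule measurable_bounded_by_integrable_imp_integrable)
    have "continuous_on ({0..1} - S) (\<lambda>t. ?d (f (\<gamma> t)) * cmod (?h t))"
      by (intro continuous_intros cS continuous_on_subset[OF c1] continuous_on_subset[OF c2])
         (use lt(1) in force)+
    then show "(\<lambda>t. ?d (f (\<gamma> t)) * cmod (?h t)) \<in> borel_measurable (lebesgue_on ({0..1} - S))"
      by (rule continuous_imp_measurable_on_sets_lebesgue)
         (use S(1) in \<open>auto intro!: sets.Diff simp: finite_imp_closed\<close>)
    show "(\<lambda>t. ?d (\<gamma> t) * cmod (?g t)) integrable_on ({0..1} - S)"
      using L integrable_spike_set_eq[of "{0..1} - S" "{0..1}"] S(1)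
      by (auto simp: integrable_on_def intro: negligible_subset[OF negligible_finite[OF S(1)]])
    show "norm (?d (f (\<gamma> t)) * cmod (?h t)) \<le> ?d (\<gamma> t) * cmod (?g t)" if "t \<in> {0..1} - S" for t
      using le[of t] lt(1)[of t] that by auto
    show "{0..1} - S \<in> sets lebesgue"
      using S(1) by (auto intro!: sets.Diff simp: finite_imp_closed)
  qed
  then have "(\<lambda>t. ?d (f (\<gamma> t)) * cmod (?h t)) integrable_on {0..1}"
    using integrable_spike_set_eq[of "{0..1} - S" "{0..1}"] S(1)
    by (auto intro: negligible_subset[OF negligible_finite[OF S(1)]])
  then obtain L' where L': "((\<lambda>t. ?d (f (\<gamma> t)) * cmod (?h t)) has_integral L') {0..1}"
    by (auto simp: integrable_on_def)
  show ?thesis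
  proof
    show "hyp_length (f \<circ> \<gamma>) L'"
      using hyp_length_cong[OF S(1) der] L' by simp
    have "((\<lambda>t. if t \<in> S then ?d (\<gamma> t) * cmod (?g t) else ?d (f (\<gamma> t)) * cmod (?h t)) has_integral L') {0..1}"
      by (rule has_integral_spike_finite[OF S(1) _ L']) auto
    then show "L' \<le> L"
      by (rule has_integral_le[OF _ L]) (use le in auto)
  qed
qed

section \<open>The infimum of lengths: Euclidean comparison, metric axioms, contraction\<close>

lemma hyp_length_bdd_below:
  "bdd_below {L. \<exists>\<gamma>. valid_path \<gamma> \<and> path_image \<gamma> \<subseteq> unit_disc \<and>
     pathstart \<gamma> = a \<and> pathfinish \<gamma> = b \<and> hyp_length \<gamma> L}"
proof (rule bdd_belowI[of _ 0], clarify)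
  fix L \<gamma> assume "valid_path \<gamma>" "path_image \<gamma> \<subseteq> unit_disc" "hyp_length \<gamma> L"
  from order_trans[OF _ hyp_length_lower[OF this]] show "0 \<le> L"
    by simp
qed

lemma poincare_dist_le:
  assumes "valid_path \<gamma>" "path_image \<gamma> \<subseteq> unit_disc" "hyp_length \<gamma> L"
  shows "poincare_dist (pathstart \<gamma>) (pathfinish \<gamma>) \<le> L"
  unfolding poincare_dist_eq
proof (rule cInf_lower)
  show "bdd_below {L. \<exists>\<gamma>'. valid_path \<gamma>' \<and> path_image \<gamma>' \<subseteq> unit_disc \<and>
     pathstart \<gamma>' = pathstart \<gamma> \<and> pathfinish \<gamma>' = pathfinish \<gamma> \<and> hyp_length \<gamma>' L}"
    by (rule hyp_length_bdd_below)
qed (use assms in blast)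

text \<open>A segment with endpoints in the closed disc of radius \<open>r\<close> stays there by
  convexity, where the density is at most that at radius \<open>r\<close>. The existence of this one
  length also makes the infimum range over a nonempty set.\<close>

lemma hyp_length_linepath:
  assumes "a \<in> unit_disc" "b \<in> unit_disc"
  obtains L where "hyp_length (linepath a b) L"
    "\<And>r. r < 1 \<Longrightarrow> cmod a \<le> r \<Longrightarrow> cmod b \<le> r \<Longrightarrow> L \<le> 2 / (1 - r\<^sup>2) * cmod (b - a)"
proof -
  have seg: "linepath a b t \<in> cball 0 r" if "t \<in> {0..1}" "cmod a \<le> r" "cmod b \<le> r" for t r
    using that closed_segment_subset[of a "cball 0 r" b] linepath_in_path[of t a b] by auto
  define m where "m = max (cmod a) (cmod b)"
  have m: "m < 1" "cmod a \<le> m" "cmod b \<le> m"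
    using assms by (auto simp: m_def)
  have lt: "(cmod (linepath a b t))\<^sup>2 < 1" if "t \<in> {0..1}" for t
    using seg[OF that m(2,3)] m(1) by (auto simp: power_less_one_iff)
  have "continuous_on {0..1} (\<lambda>t. 2 / (1 - (cmod (linepath a b t))\<^sup>2) * cmod (b - a))"
    by (intro continuous_intros) (use lt in force)
  then obtain L where L: "((\<lambda>t. 2 / (1 - (cmod (linepath a b t))\<^sup>2) * cmod (b - a)) has_integral L) {0..1}"
    using integrable_continuous_interval integrable_on_def by metis
  show ?thesis
  proof
    show "hyp_length (linepath a b) L"
      using L hyp_length_cong[of "{}" "linepath a b" "\<lambda>_. b - a" L] has_vector_derivative_linepath_within[of a b _ UNIV]
      by simp
    fix r :: real assume r: "r < 1" "cmod a \<le> r" "cmod b \<le> r"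
    have "0 \<le> r"
      using r(2) norm_ge_zero[of a] by linarith
    have "((\<lambda>t::real. 2 / (1 - r\<^sup>2) * cmod (b - a)) has_integral 2 / (1 - r\<^sup>2) * cmod (b - a)) {0..1}"
      using has_integral_const_real[of "2 / (1 - r\<^sup>2) * cmod (b - a)" 0 1] by simp
    then show "L \<le> 2 / (1 - r\<^sup>2) * cmod (b - a)"
    proof (rule has_integral_le[OF L])
      fix t :: real assume t: "t \<in> {0..1}"
      have "(cmod (linepath a b t))\<^sup>2 \<le> r\<^sup>2"
        using seg[OF t r(2,3)] by (auto simp: power_mono)
      moreover have "r\<^sup>2 < 1"
        using r(1) \<open>0 \<le> r\<close> by (simp add: power_less_one_iff)
      ultimately show "2 / (1 - (cmod (linepath a b t))\<^sup>2) * cmod (b - a) \<le> 2 / (1 - r\<^sup>2) * cmod (b - a)"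
        by (intro mult_right_mono divide_left_mono) (use lt[OF t] in auto)
    qed
  qed
qed

lemma poincare_dist_attained:
  assumes "a \<in> unit_disc" "b \<in> unit_disc" "e > 0"
  obtains \<gamma> L where "valid_path \<gamma>" "path_image \<gamma> \<subseteq> unit_disc" "pathstart \<gamma> = a" "pathfinish \<gamma> = b"
    "hyp_length \<gamma> L" "L < poincare_dist a b + e"
proof -
  let ?A = "{L. \<exists>\<gamma>. valid_path \<gamma> \<and> path_image \<gamma> \<subseteq> unit_disc \<and>
     pathstart \<gamma> = a \<and> pathfinish \<gamma> = b \<and> hyp_length \<gamma> L}"
  obtain L0 where "hyp_length (linepath a b) L0"
    using hyp_length_linepath[OF assms(1,2)] by metis
  moreover have "path_image (linepath a b) \<subseteq> unit_disc"
    using assms closed_segment_subset[of a "unit_disc" b] by auto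
  ultimately have "L0 \<in> ?A"
    by (auto intro!: exI[of _ "linepath a b"])
  moreover have "bdd_below ?A"
    by (rule hyp_length_bdd_below)
  ultimately have "\<exists>L\<in>?A. L < poincare_dist a b + e"
    using cInf_less_iff[of ?A "poincare_dist a b + e"] assms(3)
    unfolding poincare_dist_eq[symmetric] by auto
  then show ?thesis
    using that by blast
qed

text \<open>Together with \<open>poincare_dist_upper\<close> this comparison with the Euclidean
  distance takes the place of a closed formula.\<close>

lemma poincare_dist_lower:
  assumes "a \<in> unit_disc" "b \<in> unit_disc"
  shows "2 * cmod (b - a) \<le> poincare_dist a b"
proof (rule field_le_epsilon)
  fix e :: real assume "e > 0"
  obtain \<gamma> L where \<gamma>: "valid_path \<gamma>" "path_image \<gamma> \<subseteq> unit_disc" "pathstart \<gamma> = a" "pathfinish \<gamma> = b"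
    "hyp_length \<gamma> L" "L < poincare_dist a b + e"
    using poincare_dist_attained[OF assms \<open>e > 0\<close>] by metis
  then show "2 * cmod (b - a) \<le> poincare_dist a b + e"
    using hyp_length_lower[OF \<gamma>(1,2,5)] by simp
qed

lemma poincare_dist_nonneg:
  assumes "a \<in> unit_disc" "b \<in> unit_disc"
  shows "0 \<le> poincare_dist a b"
  using poincare_dist_lower[OF assms] norm_ge_zero[of "b - a"] by linarith

lemma poincare_dist_upper:
  assumes "r < 1" "cmod a \<le> r" "cmod b \<le> r"
  shows "poincare_dist a b \<le> 2 / (1 - r\<^sup>2) * cmod (b - a)"
proof -
  have ab: "a \<in> unit_disc" "b \<in> unit_disc"
    using assms by auto
  obtain L where L: "hyp_length (linepath a b) L" "L \<le> 2 / (1 - r\<^sup>2) * cmod (b - a)"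
    using hyp_length_linepath[OF ab] assms by metis
  have "path_image (linepath a b) \<subseteq> unit_disc"
    using ab closed_segment_subset[of a "unit_disc" b] by auto
  from poincare_dist_le[OF _ this L(1)] L(2) show ?thesis
    by simp
qed

lemma poincare_dist_refl: "a \<in> unit_disc \<Longrightarrow> poincare_dist a a = 0"
  using poincare_dist_upper[of "cmod a" a a] poincare_dist_nonneg[of a a] by auto

lemma poincare_dist_triangle:
  assumes "a \<in> unit_disc" "b \<in> unit_disc" "c \<in> unit_disc"
  shows "poincare_dist a c \<le> poincare_dist a b + poincare_dist b c"
proof (rule field_le_epsilon)
  fix e :: real assume e: "e > 0"
  obtain \<gamma>1 L1 where 1: "valid_path \<gamma>1" "path_image \<gamma>1 \<subseteq> unit_disc" "pathstart \<gamma>1 = a" "pathfinish \<gamma>1 = b"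
    "hyp_length \<gamma>1 L1" "L1 < poincare_dist a b + e / 2"
    using poincare_dist_attained[of a b "e / 2"] assms e by auto
  obtain \<gamma>2 L2 where 2: "valid_path \<gamma>2" "path_image \<gamma>2 \<subseteq> unit_disc" "pathstart \<gamma>2 = b" "pathfinish \<gamma>2 = c"
    "hyp_length \<gamma>2 L2" "L2 < poincare_dist b c + e / 2"
    using poincare_dist_attained[of b c "e / 2"] assms e by auto
  have "poincare_dist a c \<le> L1 + L2"
    using poincare_dist_le[of "\<gamma>1 +++ \<gamma>2" "L1 + L2"] 1 2
    by (simp add: hyp_length_join valid_path_join subset_path_image_join)
  then show "poincare_dist a c \<le> poincare_dist a b + poincare_dist b c + e"
    using 1(6) 2(6) by linarith
qed

lemma poincare_dist_commute:
  assumes "a \<in> unit_disc" "b \<in> unit_disc"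
  shows "poincare_dist a b = poincare_dist b a"
proof -
  have "poincare_dist b a \<le> poincare_dist a b" if ab: "a \<in> unit_disc" "b \<in> unit_disc" for a b
  proof (rule field_le_epsilon)
    fix e :: real assume e: "e > 0"
    obtain \<gamma> L where \<gamma>: "valid_path \<gamma>" "path_image \<gamma> \<subseteq> unit_disc" "pathstart \<gamma> = a" "pathfinish \<gamma> = b"
      "hyp_length \<gamma> L" "L < poincare_dist a b + e"
      using poincare_dist_attained[OF ab e] by metis
    then show "poincare_dist b a \<le> poincare_dist a b + e"
      using poincare_dist_le[of "reversepath \<gamma>" L] by (simp add: hyp_length_reversepath)
  qed
  then show ?thesis
    using assms by (simp add: antisym)
qed

text \<open>The image of an almost shortest path joins the image points and is no longer than the
  path.\<close>

theorem Schwarz_Pick: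
  assumes f: "f holomorphic_on unit_disc" "f ` unit_disc \<subseteq> unit_disc"
    and ab: "a \<in> unit_disc" "b \<in> unit_disc"
  shows "poincare_dist (f a) (f b) \<le> poincare_dist a b"
proof (rule field_le_epsilon)
  fix e :: real assume e: "e > 0"
  obtain \<gamma> L where \<gamma>: "valid_path \<gamma>" "path_image \<gamma> \<subseteq> unit_disc" "pathstart \<gamma> = a" "pathfinish \<gamma> = b"
    "hyp_length \<gamma> L" "L < poincare_dist a b + e"
    using poincare_dist_attained[OF ab e] by metis
  obtain L' where L': "L' \<le> L" "hyp_length (f \<circ> \<gamma>) L'"
    using hyp_length_compose[OF f \<gamma>(1,2,5)] by metis
  have "valid_path (f \<circ> \<gamma>)"
    by (rule valid_path_compose_holomorphic[OF \<gamma>(1) f(1) open_ball \<gamma>(2)])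
  moreover have "path_image (f \<circ> \<gamma>) \<subseteq> unit_disc"
    using \<gamma>(2) f(2) by (auto simp: path_image_compose)
  ultimately have "poincare_dist (f a) (f b) \<le> L'"
    using poincare_dist_le[of "f \<circ> \<gamma>" L'] L'(2) \<gamma>(3,4)
    by (simp add: pathstart_compose pathfinish_compose)
  then show "poincare_dist (f a) (f b) \<le> poincare_dist a b + e"
    using L'(1) \<gamma>(6) by linarith
qed

section \<open>Rado's theorem\<close>

lemma open_nonzero_ball:
  fixes u :: "complex \<Rightarrow> complex"
  assumes "continuous_on (cball c R) u"
  shows "open {z \<in> ball c R. u z \<noteq> 0}"
proof -
  have "open (ball c R \<inter> u -` (- {0}))"
    by (rule continuous_open_preimage[OF continuous_on_subset[OF assms ball_subset_cball]]) auto
  also have "ball c R \<inter> u -` (- {0}) = {z \<in> ball c R. u z \<noteq> 0}"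
    by auto
  finally show ?thesis .
qed

text \<open>Comparing \<open>F ^ n * u\<close> with its boundary values for large \<open>n\<close> makes the factor \<open>u\<close>, which
  vanishes on the part of the frontier inside the disc, disappear.\<close>

lemma max_modulus_off_zeros:
  fixes F u :: "complex \<Rightarrow> complex" and c :: complex and R :: real
  defines "V \<equiv> {z \<in> ball c R. u z \<noteq> 0}"
  assumes u: "continuous_on (cball c R) u" "u holomorphic_on V"
    and F: "continuous_on (closure V) F" "F holomorphic_on V"
    and M: "M > 0" "\<And>z. z \<in> sphere c R \<Longrightarrow> z \<in> closure V \<Longrightarrow> cmod (F z) \<le> M"
    and \<alpha>: "\<alpha> \<in> V"
  shows "cmod (F \<alpha>) \<le> M"
proof (rule ccontr)
  assume "\<not> cmod (F \<alpha>) \<le> M"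
  then have gt: "cmod (F \<alpha>) / M > 1"
    using M by simp
  have oV: "open V"
    unfolding V_def by (rule open_nonzero_ball[OF u(1)])
  have clV: "closure V \<subseteq> cball c R"
    by (rule closure_minimal) (auto simp: V_def)
  obtain K where K: "K > 0" "\<And>z. z \<in> cball c R \<Longrightarrow> cmod (u z) \<le> K"
    using compact_imp_bounded[OF compact_continuous_image[OF u(1) compact_cball]]
    by (auto simp: bounded_pos)
  have bound: "cmod (F \<alpha> ^ n * u \<alpha>) \<le> M ^ n * K" for n
  proof (rule maximum_modulus_frontier[of "\<lambda>z. F z ^ n * u z" V])
    show "(\<lambda>z. F z ^ n * u z) holomorphic_on interior V"
      using oV F u by (auto simp: interior_open intro!: holomorphic_intros)
    show "continuous_on (closure V) (\<lambda>z. F z ^ n * u z)"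
      by (intro continuous_intros F continuous_on_subset[OF u(1) clV])
    show "bounded V"
      using clV bounded_cball bounded_subset closure_subset by (metis order_trans)
    show "\<alpha> \<in> V" by fact
    fix z assume z: "z \<in> frontier V"
    then have zc: "z \<in> closure V" "z \<notin> V"
      using oV by (auto simp: frontier_def interior_open)
    then have z': "z \<in> cball c R"
      using clV by auto
    show "cmod (F z ^ n * u z) \<le> M ^ n * K"
    proof (cases "z \<in> ball c R")
      case True
      then show ?thesis
        using zc(2) M(1) K(1) by (simp add: V_def)
    next
      case False
      then have "z \<in> sphere c R"
        using z' by auto
      then show ?thesis
        using M(1) K M(2)[OF _ zc(1)] z'
        by (auto simp: norm_mult norm_power intro!: mult_mono power_mono)
    qed
  qed
  have u0: "cmod (u \<alpha>) > 0"
    using \<alpha> by (simp add: V_def)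
  obtain n where n: "K / cmod (u \<alpha>) < (cmod (F \<alpha>) / M) ^ n"
    using real_arch_pow[OF gt] by blast
  have "(cmod (F \<alpha>) / M) ^ n \<le> K / cmod (u \<alpha>)"
    using bound[of n] u0 M(1) by (simp add: field_simps norm_mult norm_power)
  with n show False
    by simp
qed

text \<open>If \<open>u\<close> vanished on an open part \<open>O'\<close> of the disc, a pole
  placed in \<open>O'\<close> just beyond the closure of \<open>V\<close> would give a function that
  is moderate on the circle but huge at a nearby point of \<open>V\<close>, against the maximum
  principle above.\<close>

lemma dense_off_zeros:
  fixes u :: "complex \<Rightarrow> complex" and c :: complex and R :: real
  defines "V \<equiv> {z \<in> ball c R. u z \<noteq> 0}"
  assumes u: "continuous_on (cball c R) u" "u holomorphic_on V" and "V \<noteq> {}"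
  shows "cball c R \<subseteq> closure V"
proof -
  have "R > 0"
    using \<open>V \<noteq> {}\<close> by (auto simp: V_def intro: le_less_trans[OF zero_le_dist])
  have "ball c R \<subseteq> closure V"
  proof (rule ccontr)
    assume "\<not> ball c R \<subseteq> closure V"
    define O' where "O' = ball c R - closure V"
    have O': "O' \<noteq> {}" "O' \<subseteq> ball c R" "open O'"
      using \<open>\<not> ball c R \<subseteq> closure V\<close> by (auto simp: O'_def open_Diff)
    have "V \<subseteq> ball c R - O'"
      using closure_subset[of V] by (auto simp: V_def O'_def)
    \<comment> \<open>The disc is connected and meets both \<open>O'\<close> and its complement, so
      \<open>O'\<close> has a frontier point inside it.\<close>
    then have "ball c R \<inter> frontier O' \<noteq> {}"
      using O' \<open>V \<noteq> {}\<close> by (intro connected_Int_frontier) auto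
    then obtain p where p: "p \<in> ball c R" "p \<in> closure O'" "p \<notin> O'"
      using O' by (auto simp: frontier_def interior_open)
    then have "p \<in> closure V"
      by (simp add: O'_def)
    define d where "d = R - dist c p"
    have d: "d > 0"
      using p by (simp add: d_def)
    obtain \<alpha> where \<alpha>: "\<alpha> \<in> V" "dist \<alpha> p < d / 8"
      using \<open>p \<in> closure V\<close> d closure_approachable[of p V] by (metis divide_pos_pos zero_less_numeral)
    \<comment> \<open>The pole cannot be \<open>p\<close>, which lies in the closure of
      \<open>V\<close>. From \<open>\<beta>\<close> the circle is at distance at least 7d/8, while
      \<open>\<alpha>\<close> is nearer than d/4.\<close>
    obtain \<beta> where \<beta>: "\<beta> \<in> O'" "dist \<beta> p < d / 8"
      using p(2) d closure_approachable[of p O'] by (metis divide_pos_pos zero_less_numeral)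
    have nz: "z \<noteq> \<beta>" if "z \<in> closure V" for z
      using that \<beta>(1) by (auto simp: O'_def)
    have "cmod (1 / (\<alpha> - \<beta>)) \<le> 8 / (7 * d)"
    proof (rule max_modulus_off_zeros[of c R u "\<lambda>z. 1 / (z - \<beta>)"])
      show "continuous_on (closure {z \<in> ball c R. u z \<noteq> 0}) (\<lambda>z. 1 / (z - \<beta>))"
        using nz by (auto intro!: continuous_intros simp: V_def)
      show "(\<lambda>z. 1 / (z - \<beta>)) holomorphic_on {z \<in> ball c R. u z \<noteq> 0}"
        using nz closure_subset[of V] by (auto intro!: holomorphic_intros simp: V_def)
      fix z assume "z \<in> sphere c R"
      then have "dist z p \<ge> d"
        using dist_triangle[of c z p] by (simp add: d_def dist_commute)
      then have "dist z \<beta> \<ge> 7 * d / 8"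
        using dist_triangle[of z p \<beta>] \<beta>(2) by (simp add: dist_commute)
      then have "1 / dist z \<beta> \<le> 1 / (7 * d / 8)"
        using d by (intro divide_left_mono mult_pos_pos) (auto simp del: zero_less_dist_iff)
      then show "cmod (1 / (z - \<beta>)) \<le> 8 / (7 * d)"
        by (simp add: norm_divide dist_norm)
    qed (use u \<alpha> d in \<open>auto simp: V_def\<close>)
    moreover have "0 < dist \<alpha> \<beta>"
      using nz[of \<alpha>] \<alpha>(1) closure_subset[of V] by auto
    moreover have "dist \<alpha> \<beta> < d / 4"
      using dist_triangle[of \<alpha> \<beta> p] \<alpha>(2) \<beta>(2) by (simp add: dist_commute)
    ultimately show False
      using d by (simp add: norm_divide dist_norm field_simps)
  qed
  then have "closure (ball c R) \<subseteq> closure V"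
    by (rule closure_minimal) simp
  then show ?thesis
    using \<open>R > 0\<close> by simp
qed

text \<open>On a circle centred at \<open>0\<close>, these are the trigonometric polynomials.\<close>

inductive trig_poly :: "(complex \<Rightarrow> real) \<Rightarrow> bool" where
  monom: "trig_poly (\<lambda>z. Re (a * z ^ n))"
| add: "trig_poly f \<Longrightarrow> trig_poly g \<Longrightarrow> trig_poly (\<lambda>z. f z + g z)"

text \<open>The representation by powers of z extends a trigonometric polynomial from the circle to
  a harmonic function with an explicit conjugate.\<close>

lemma trig_poly_holomorphic:
  assumes "trig_poly f"
  obtains P where "P holomorphic_on UNIV" "\<And>z. f z = Re (P z)"
  using assms
proof (induction arbitrary: thesis)
  case (monom a n)
  show ?case
    by (rule monom[of "\<lambda>z. a * z ^ n"]) (auto intro!: holomorphic_intros)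
next
  case (add f g)
  obtain P Q where "P holomorphic_on UNIV" "\<And>z. f z = Re (P z)"
    "Q holomorphic_on UNIV" "\<And>z. g z = Re (Q z)"
    using add.IH by metis
  then show ?case
    by (intro add.prems[of "\<lambda>z. P z + Q z"]) (auto intro!: holomorphic_intros)
qed

text \<open>Uses Re w * Re w' = Re (w w') / 2 + Re (w cnj w') / 2. On the circle z * cnj z is
  constant, so each conjugate power cancels a power of z; \<open>m \<le> n\<close> ensures that no
  negative exponent remains.\<close>

lemma trig_poly_mult_monom:
  assumes "m \<le> n"
  shows "\<exists>h. trig_poly h \<and> (\<forall>z\<in>sphere 0 R. Re (a * z ^ n) * Re (b * z ^ m) = h z)"
proof -
  let ?h = "\<lambda>z. Re (a * b / 2 * z ^ (n + m)) + Re (a * cnj b * of_real (R ^ (2 * m)) / 2 * z ^ (n - m))"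
  have "Re (a * z ^ n) * Re (b * z ^ m) = ?h z" if "z \<in> sphere 0 R" for z
  proof -
    have "z * cnj z = of_real (R\<^sup>2)"
      using that complex_norm_square[of z] by simp
    then have 1: "z ^ m * cnj (z ^ m) = of_real (R ^ (2 * m))"
      by (simp add: power_mult_distrib[symmetric] power_mult)
    have "z ^ n = z ^ (n - m) * z ^ m"
      using assms by (simp add: power_add[symmetric])
    then have "(a * z ^ n) * cnj (b * z ^ m) = a * cnj b * (z ^ m * cnj (z ^ m)) * z ^ (n - m)"
      by (simp add: algebra_simps)
    then have 2: "(a * z ^ n) * cnj (b * z ^ m) = a * cnj b * of_real (R ^ (2 * m)) * z ^ (n - m)"
      unfolding 1 .
    have 3: "(a * z ^ n) * (b * z ^ m) = a * b * z ^ (n + m)"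
      by (simp add: power_add algebra_simps)
    have "Re w * Re w' = Re ((w * w') / 2) + Re ((w * cnj w') / 2)" for w w'
      by (simp add: field_simps)
    then have "Re (a * z ^ n) * Re (b * z ^ m)
        = Re (((a * z ^ n) * (b * z ^ m)) / 2) + Re (((a * z ^ n) * cnj (b * z ^ m)) / 2)" .
    then show ?thesis
      unfolding 2 3 times_divide_eq_left .
  qed
  then show ?thesis
    by (intro exI[of _ ?h] conjI trig_poly.intros) auto
qed

lemma trig_poly_mult:
  assumes "trig_poly f" "trig_poly g"
  shows "\<exists>h. trig_poly h \<and> (\<forall>z\<in>sphere 0 R. f z * g z = h z)"
  using assms(1)
proof (induction rule: trig_poly.induct)
  case (monom a n)
  show ?case
    using assms(2)
  proof (induction rule: trig_poly.induct)
    case (monom b m)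
    show ?case
    proof (cases "m \<le> n")
      case False
      then show ?thesis
        using trig_poly_mult_monom[of n m R b a] by (simp add: mult.commute)
    qed (rule trig_poly_mult_monom)
  next
    case (add g g')
    then obtain h h' where "trig_poly h" "\<forall>z\<in>sphere 0 R. Re (a * z ^ n) * g z = h z"
      "trig_poly h'" "\<forall>z\<in>sphere 0 R. Re (a * z ^ n) * g' z = h' z"
      by blast
    then show ?case
      by (intro exI[of _ "\<lambda>z. h z + h' z"] conjI trig_poly.add) (simp_all add: distrib_left)
  qed
next
  case (add f f')
  then obtain h h' where "trig_poly h" "\<forall>z\<in>sphere 0 R. f z * g z = h z"
    "trig_poly h'" "\<forall>z\<in>sphere 0 R. f' z * g z = h' z"
    by blast
  then show ?case
    by (intro exI[of _ "\<lambda>z. h z + h' z"] conjI trig_poly.add) (simp_all add: distrib_right)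
qed

text \<open>Stone-Weierstrass for trigonometric polynomials; it stands in for solving the Dirichlet
  problem with boundary values \<open>\<phi>\<close>.\<close>

lemma circle_approx_Re_holomorphic:
  fixes \<phi> :: "complex \<Rightarrow> real"
  assumes "continuous_on (sphere 0 R) \<phi>" "e > 0"
  obtains P where "P holomorphic_on UNIV" "\<And>z. z \<in> sphere 0 R \<Longrightarrow> \<bar>\<phi> z - Re (P z)\<bar> < e"
proof -
  \<comment> \<open>Agreement is demanded on the circle only, because products of trigonometric
    polynomials are reduced to sums only there.\<close>
  let ?P = "\<lambda>f. \<exists>g. trig_poly g \<and> (\<forall>z\<in>sphere 0 R. f z = g z)"
  have "\<exists>f. ?P f \<and> (\<forall>z\<in>sphere 0 R. \<bar>\<phi> z - f z\<bar> < e)"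
  proof (rule Stone_Weierstrass_HOL)
    show "?P (\<lambda>z. c)" for c
      using trig_poly.monom[of "of_real c" 0] by auto
    show "continuous_on (sphere 0 R) f" if f: "?P f" for f
    proof -
      obtain g where g: "trig_poly g" "\<forall>z\<in>sphere 0 R. f z = g z"
        using f by blast
      obtain P where P: "P holomorphic_on UNIV" "\<And>z. g z = Re (P z)"
        using trig_poly_holomorphic[OF g(1)] by metis
      have "continuous_on (sphere 0 R) (\<lambda>z. Re (P z))"
        by (intro continuous_intros holomorphic_on_imp_continuous_on holomorphic_on_subset[OF P(1)]) auto
      then show ?thesis
        using g(2) P(2) by (metis (no_types, lifting) continuous_on_cong)
    qed
    show "?P (\<lambda>z. f z + g z)" if fg: "?P f \<and> ?P g" for f g
    proof -
      obtain f' g' where "trig_poly f'" "\<forall>z\<in>sphere 0 R. f z = f' z" "trig_poly g'" "\<forall>z\<in>sphere 0 R. g z = g' z"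
        using fg by blast
      then show ?thesis
        by (intro exI[of _ "\<lambda>z. f' z + g' z"]) (auto intro: trig_poly.add)
    qed
    show "?P (\<lambda>z. f z * g z)" if fg: "?P f \<and> ?P g" for f g
    proof -
      obtain f' g' where fg': "trig_poly f'" "\<forall>z\<in>sphere 0 R. f z = f' z" "trig_poly g'" "\<forall>z\<in>sphere 0 R. g z = g' z"
        using fg by blast
      with trig_poly_mult[of f' g' R] show ?thesis
        by auto
    qed
    show "\<exists>f. ?P f \<and> f x \<noteq> f y" if "x \<in> sphere 0 R \<and> y \<in> sphere 0 R \<and> x \<noteq> y" for x y
    proof (cases "Re x = Re y")
      case True
      then have "Re (\<i> * x ^ 1) \<noteq> Re (\<i> * y ^ 1)"
        using that by (auto simp: complex_eq_iff)
      then show ?thesis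
        using trig_poly.monom[of \<i> 1] by (intro exI[of _ "\<lambda>z. Re (\<i> * z ^ 1)"]) blast
    next
      case False
      then have "Re (1 * x ^ 1) \<noteq> Re (1 * y ^ 1)"
        by simp
      then show ?thesis
        using trig_poly.monom[of 1 1] by (intro exI[of _ "\<lambda>z. Re (1 * z ^ 1)"]) blast
    qed
  qed (use assms in auto)
  then obtain g where g: "trig_poly g" "\<forall>z\<in>sphere 0 R. \<bar>\<phi> z - g z\<bar> < e"
    by auto
  obtain P where "P holomorphic_on UNIV" "\<And>z. g z = Re (P z)"
    using trig_poly_holomorphic[OF g(1)] by metis
  then show ?thesis
    using g(2) by (intro that[of P]) auto
qed

text \<open>The approximants \<open>P\<close> of the real part on the circle are controlled on the disc by applying
  the maximum principle to \<open>exp (k - P)\<close>. Exponentials of approximants form a normal family.\<close>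

lemma Re_eq_Re_holomorphic:
  fixes u k :: "complex \<Rightarrow> complex" and R :: real
  defines "V \<equiv> {z \<in> ball 0 R. u z \<noteq> 0}"
  assumes u: "continuous_on (cball 0 R) u" "u holomorphic_on V" and "V \<noteq> {}"
    and k: "continuous_on (cball 0 R) k" "k holomorphic_on V"
  obtains P where "P holomorphic_on ball 0 R" "\<And>z. z \<in> ball 0 R \<Longrightarrow> Re (k z) = Re (P z)"
proof -
  have clV: "closure V \<subseteq> cball 0 R"
    by (rule closure_minimal) (auto simp: V_def)
  have dense: "cball 0 R \<subseteq> closure V"
    using dense_off_zeros[of 0 R u] assms by simp
  have ck: "continuous_on (closure V) k"
    by (rule continuous_on_subset[OF k(1) clV])
  have approx: "\<exists>P. P holomorphic_on UNIV \<and> (\<forall>z\<in>cball 0 R. \<bar>Re (k z) - Re (P z)\<bar> \<le> e)" if e: "e > 0" for e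
  proof -
    have "continuous_on (sphere 0 R) (\<lambda>z. Re (k z))"
      by (intro continuous_intros continuous_on_subset[OF k(1)]) auto
    then obtain P where P: "P holomorphic_on UNIV" "\<And>z. z \<in> sphere 0 R \<Longrightarrow> \<bar>Re (k z) - Re (P z)\<bar> < e"
      using circle_approx_Re_holomorphic[OF _ e] by metis
    have P': "P holomorphic_on A" "continuous_on A P" for A
      using P(1) by (auto intro: holomorphic_on_subset holomorphic_on_imp_continuous_on)
    have 1: "cmod (exp (k z - P z)) \<le> exp e" if "z \<in> V" for z
      by (rule max_modulus_off_zeros[of 0 R u "\<lambda>z. exp (k z - P z)"])
         (use u that P' ck k(2) P(2) in \<open>force simp: V_def intro!: continuous_intros holomorphic_intros\<close>)+
    have 2: "cmod (exp (P z - k z)) \<le> exp e" if "z \<in> V" for z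
      by (rule max_modulus_off_zeros[of 0 R u "\<lambda>z. exp (P z - k z)"])
         (use u that P' ck k(2) P(2) in \<open>force simp: V_def intro!: continuous_intros holomorphic_intros\<close>)+
    \<comment> \<open>The modulus of an exponential is the exponential of the real part, so the two
      bounds control the difference from both sides on \<open>V\<close>, and by continuity on its
      closure, which is the closed disc.\<close>
    have "norm (Re (k z) - Re (P z)) \<le> e" if "z \<in> closure V" for z
    proof (rule continuous_on_closure_norm_le[OF _ _ that])
      show "continuous_on (closure V) (\<lambda>z. Re (k z) - Re (P z))"
        by (intro continuous_intros ck P')
      show "\<forall>y\<in>V. norm (Re (k y) - Re (P y)) \<le> e"
        using 1 2 by (auto simp: abs_le_iff)
    qed
    then show ?thesis
      using P(1) dense by auto
  qed
  have "\<forall>n. \<exists>P. P holomorphic_on UNIV \<and> (\<forall>z\<in>cball 0 R. \<bar>Re (k z) - Re (P z)\<bar> \<le> 1 / Suc n)"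
    using approx by simp
  then obtain P where P: "\<And>n. P n holomorphic_on UNIV"
    "\<And>n z. z \<in> cball 0 R \<Longrightarrow> \<bar>Re (k z) - Re (P n z)\<bar> \<le> 1 / Suc n"
    by metis
  obtain K where K: "\<And>z. z \<in> cball 0 R \<Longrightarrow> cmod (k z) \<le> K"
    using compact_imp_bounded[OF compact_continuous_image[OF k(1) compact_cball]]
    by (fastforce simp: bounded_iff)
  have bd: "cmod (exp (P n z)) \<le> exp (K + 1)" if "z \<in> cball 0 R" for n z
  proof -
    have "1 / Suc n \<le> (1 :: real)"
      by simp
    then have "Re (P n z) \<le> K + 1"
      using P(2)[OF that, of n] K[OF that] complex_Re_le_cmod[of "k z"] by linarith
    then show ?thesis
      by simp
  qed
  \<comment> \<open>Only the real parts of the approximants are controlled; their imaginary parts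
    may drift, so the \<open>P n\<close> themselves need not converge. Their exponentials are
    uniformly bounded.\<close>
  obtain G r where G: "G holomorphic_on ball 0 R" "strict_mono (r :: nat \<Rightarrow> nat)"
    "\<And>z. z \<in> ball 0 R \<Longrightarrow> (\<lambda>n. exp (P (r n) z)) \<longlonglongrightarrow> G z"
  proof (rule Montel[of "ball 0 R" "range (\<lambda>n z. exp (P n z))" "\<lambda>n z. exp (P n z)"])
    show "h holomorphic_on ball 0 R" if "h \<in> range (\<lambda>n z. exp (P n z))" for h
      using that P(1) by (auto intro!: holomorphic_intros intro: holomorphic_on_subset)
    show "\<exists>B. \<forall>h\<in>range (\<lambda>n z. exp (P n z)). \<forall>z\<in>C. cmod (h z) \<le> B"
      if "compact C" "C \<subseteq> ball 0 R" for C
      using bd that by (intro exI[of _ "exp (K + 1)"]) auto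
  qed auto
  have nG: "cmod (G z) = exp (Re (k z))" if z: "z \<in> ball 0 R" for z
  proof -
    have "(\<lambda>n. Re (P n z)) \<longlonglongrightarrow> Re (k z)"
    proof (rule LIM_zero_cancel, rule Lim_null_comparison)
      show "\<forall>\<^sub>F n in sequentially. norm (Re (P n z) - Re (k z)) \<le> 1 / Suc n"
        using P(2)[of z] z by (auto simp: abs_minus_commute)
      show "(\<lambda>n. 1 / real (Suc n)) \<longlonglongrightarrow> 0"
        using LIMSEQ_inverse_real_of_nat by (simp add: inverse_eq_divide)
    qed
    then have "(\<lambda>n. exp (Re (P (r n) z))) \<longlonglongrightarrow> exp (Re (k z))"
      using LIMSEQ_subseq_LIMSEQ[OF _ G(2)] by (force simp: o_def intro: tendsto_exp)
    moreover have "(\<lambda>n. cmod (exp (P (r n) z))) \<longlonglongrightarrow> cmod (G z)"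
      by (intro tendsto_norm G z)
    ultimately show ?thesis
      using LIMSEQ_unique by (force simp: norm_exp_eq_Re)
  qed
  \<comment> \<open>Since |G| = exp (Re k), the limit has no zeros and therefore a holomorphic
    logarithm on the disc, whose real part is Re k.\<close>
  then have "G z \<noteq> 0" if "z \<in> ball 0 R" for z
    using that by force
  then obtain Q where Q: "Q holomorphic_on ball 0 R" "\<And>z. z \<in> ball 0 R \<Longrightarrow> G z = exp (Q z)"
    using contractible_imp_holomorphic_log[OF G(1) convex_imp_contractible[OF convex_ball]] by metis
  show ?thesis
    using that[OF Q(1)] nG Q(2) by simp
qed

text \<open>Here |exp f| = 1, so the maximum modulus principle makes exp f locally constant, and
  differentiating gives f' = 0.\<close>

lemma deriv_zero_of_Re_zero:
  assumes f: "f holomorphic_on S" "open S" "\<And>z. z \<in> S \<Longrightarrow> Re (f z) = 0" and "a \<in> S"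
  shows "deriv f a = 0"
proof -
  obtain e where e: "e > 0" "ball a e \<subseteq> S"
    using f(2) \<open>a \<in> S\<close> open_contains_ball by blast
  have "(\<lambda>z. exp (f z)) constant_on ball a e"
    using f e by (intro maximum_modulus_principle[of _ _ "ball a e" a])
      (auto intro!: holomorphic_intros intro: holomorphic_on_subset simp: subset_eq)
  then obtain c where c: "\<And>z. z \<in> ball a e \<Longrightarrow> exp (f z) = c"
    by (auto simp: constant_on_def)
  have df: "(f has_field_derivative deriv f a) (at a)"
    using f(1,2) \<open>a \<in> S\<close> by (rule holomorphic_derivI)
  have "((\<lambda>z. exp (f z)) has_field_derivative exp (f a) * deriv f a) (at a)"
    using df by (auto intro!: derivative_eq_intros)
  moreover have "((\<lambda>z. exp (f z)) has_field_derivative 0) (at a)"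
    by (rule has_field_derivative_transform_within_open[of "\<lambda>_. c" _ _ "ball a e"]) (use e c in auto)
  ultimately show ?thesis
    using DERIV_unique by fastforce
qed

text \<open>For \<open>k = u\<close> this is Rado's theorem.\<close>

theorem Rado:
  fixes u k :: "complex \<Rightarrow> complex" and R :: real
  defines "V \<equiv> {z \<in> ball 0 R. u z \<noteq> 0}"
  assumes u: "continuous_on (cball 0 R) u" "u holomorphic_on V" and "V \<noteq> {}"
    and k: "continuous_on (cball 0 R) k" "k holomorphic_on V"
  shows "k holomorphic_on ball 0 R"
proof -
  obtain P where P: "P holomorphic_on ball 0 R" "\<And>z. z \<in> ball 0 R \<Longrightarrow> Re (k z) = Re (P z)"
    using Re_eq_Re_holomorphic[of R u k] assms by metis
  have "continuous_on (cball 0 R) (\<lambda>z. - \<i> * k z)" "(\<lambda>z. - \<i> * k z) holomorphic_on V"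
    by (intro continuous_intros holomorphic_intros k)+
  \<comment> \<open>The real part of -i k is Im k, so both parts of \<open>k\<close> are now real
    parts of holomorphic functions; it remains to see that \<open>P\<close> and \<open>Q\<close> fit
    together.\<close>
  then obtain Q where Q: "Q holomorphic_on ball 0 R" "\<And>z. z \<in> ball 0 R \<Longrightarrow> Re (- \<i> * k z) = Re (Q z)"
    using Re_eq_Re_holomorphic[of R u "\<lambda>z. - \<i> * k z"] assms by metis
  have oV: "open V"
    unfolding V_def by (rule open_nonzero_ball[OF u(1)])
  have VB: "V \<subseteq> ball 0 R"
    by (auto simp: V_def)
  \<comment> \<open>If \<open>k\<close> is holomorphic then k' = P' and -i k' = Q', so W' = 0. This
    holds on \<open>V\<close> and spreads to the disc by the identity theorem. Then Re W = Re Q - Im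
    P is constant, which gives Im k = Im P + Re c.\<close>
  define W where "W z = Q z + \<i> * P z" for z
  have W: "W holomorphic_on ball 0 R"
    unfolding W_def by (intro holomorphic_intros P Q)
  have dW: "deriv W a = 0" if a: "a \<in> V" for a
  proof -
    have D: "(k has_field_derivative deriv k a) (at a)" "(P has_field_derivative deriv P a) (at a)"
      "(Q has_field_derivative deriv Q a) (at a)"
      using holomorphic_derivI[OF k(2) oV a] holomorphic_derivI[OF P(1) open_ball]
        holomorphic_derivI[OF Q(1) open_ball] a VB by auto
    have "deriv (\<lambda>z. k z - P z) a = 0"
      by (rule deriv_zero_of_Re_zero[OF _ oV _ a])
         (use P VB k(2) in \<open>auto intro!: holomorphic_intros intro: holomorphic_on_subset\<close>)
    moreover have "deriv (\<lambda>z. - \<i> * k z - Q z) a = 0"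
      by (rule deriv_zero_of_Re_zero[OF _ oV _ a])
         (use Q VB k(2) in \<open>auto intro!: holomorphic_intros intro: holomorphic_on_subset\<close>)
    moreover have "((\<lambda>z. k z - P z) has_field_derivative deriv k a - deriv P a) (at a)"
      "((\<lambda>z. - \<i> * k z - Q z) has_field_derivative - \<i> * deriv k a - deriv Q a) (at a)"
      "(W has_field_derivative deriv Q a + \<i> * deriv P a) (at a)"
      unfolding W_def using D by (auto intro!: derivative_eq_intros)
    ultimately have "deriv k a - deriv P a = 0" "- \<i> * deriv k a - deriv Q a = 0"
      "deriv W a = deriv Q a + \<i> * deriv P a"
      by (metis DERIV_imp_deriv)+
    then show ?thesis
      by (metis add.left_inverse diff_eq_diff_eq eq_iff_diff_eq_0 minus_mult_left)
  qed
  obtain a where a: "a \<in> V"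
    using \<open>V \<noteq> {}\<close> by blast
  have dW0: "deriv W z = 0" if z: "z \<in> ball 0 R" for z
    by (rule analytic_continuation[of "deriv W" "ball 0 R" V a])
       (use W VB a oV dW z in \<open>auto intro!: holomorphic_deriv interior_limit_point simp: interior_open\<close>)
  have "W constant_on ball 0 R"
  proof (rule has_field_derivative_0_imp_constant_on[OF _ connected_ball open_ball])
    show "(W has_field_derivative 0) (at z)" if "z \<in> ball 0 R" for z
      using holomorphic_derivI[OF W open_ball that] dW0[OF that] by simp
  qed
  then obtain c where c: "\<And>z. z \<in> ball 0 R \<Longrightarrow> W z = c"
    by (auto simp: constant_on_def)
  have "k z = P z + \<i> * of_real (Re c)" if z: "z \<in> ball 0 R" for z
    using P(2)[OF z] Q(2)[OF z] c[OF z] by (auto simp: complex_eq_iff W_def)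
  moreover have "(\<lambda>z. P z + \<i> * of_real (Re c)) holomorphic_on ball 0 R"
    by (intro holomorphic_intros P)
  ultimately show ?thesis
    by (metis (no_types, lifting) holomorphic_cong)
qed

section \<open>Holomorphic functions of several variables\<close>

definition pderivc :: "(complex ^ 'n \<Rightarrow> complex) \<Rightarrow> 'n \<Rightarrow> complex ^ 'n \<Rightarrow> complex" where
  "pderivc f i x = deriv (\<lambda>t. f (x + axis i t)) 0"

definition sep_holomorphic :: "(complex ^ 'n \<Rightarrow> complex) \<Rightarrow> (complex ^ 'n) set \<Rightarrow> bool" where
  "sep_holomorphic f S \<longleftrightarrow> (\<forall>x\<in>S. \<forall>i. (\<lambda>t. f (x + axis i t)) field_differentiable (at 0))"

lemma norm_axis_complex [simp]: "norm (axis i t :: complex ^ 'n) = cmod t"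
proof -
  have "norm (axis i t :: complex ^ 'n) = sqrt (\<Sum>j\<in>UNIV. (if j = i then (cmod t)\<^sup>2 else 0))"
    unfolding norm_vec_def L2_set_def by (intro arg_cong[of _ _ sqrt] sum.cong) (auto simp: axis_def)
  then show ?thesis
    by simp
qed

lemma axis_add: "axis i (s + t) = axis i s + (axis i t :: complex ^ 'n)"
  by (simp add: vec_eq_iff axis_def)

lemma axis_zero [simp]: "axis i 0 = (0 :: complex ^ 'n)"
  by (simp add: vec_eq_iff axis_def)

lemma continuous_on_axis [continuous_intros]:
  "continuous_on A g \<Longrightarrow> continuous_on A (\<lambda>t. axis i (g t) :: complex ^ 'n)"
  unfolding axis_def
proof (rule continuous_on_vec_lambda)
  show "continuous_on A (\<lambda>t. if j = i then g t else 0)" if "continuous_on A g" for j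
    using that by (cases "j = i") simp_all
qed

text \<open>\<open>sep_holomorphic\<close> speaks of the parameter 0 only; moving the base point
  along the line reaches the other parameters.\<close>

lemma sep_holomorphic_has_derivative:
  assumes "sep_holomorphic f S" "x + axis i t \<in> S"
  shows "((\<lambda>t. f (x + axis i t)) has_field_derivative pderivc f i (x + axis i t)) (at t)"
proof -
  have "((\<lambda>s. f (x + axis i t + axis i s)) has_field_derivative pderivc f i (x + axis i t)) (at 0)"
    using assms unfolding sep_holomorphic_def pderivc_def
    by (simp add: field_differentiable_derivI)
  then have "((\<lambda>s. f (x + axis i (s + t))) has_field_derivative pderivc f i (x + axis i t)) (at 0)"
    by (simp add: axis_add add_ac)
  then show ?thesis
    using DERIV_shift[of "\<lambda>s. f (x + axis i s)" _ 0 t] by simp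
qed

text \<open>Cauchy's inequality, applied to the difference of \<open>f\<close> along two parallel
  lines, bounds the difference of the derivatives by that of the values, which is small by uniform
  continuity.\<close>

lemma pderivc_continuous:
  assumes S: "open S" and f: "continuous_on S f" "sep_holomorphic f S"
  shows "continuous_on S (pderivc f i)"
  unfolding continuous_on_iff
proof (intro ballI allI impI)
  fix x0 and e :: real assume x0: "x0 \<in> S" and e: "e > 0"
  obtain r where r: "r > 0" "cball x0 r \<subseteq> S"
    using S x0 open_contains_cball by blast
  \<comment> \<open>Base points move by at most \<open>R\<close> and parameters by at most
    \<open>R\<close>, so everything happens in the closed ball of radius
    \<open>2 * R\<close>.\<close>
  define R where "R = r / 2"
  have R: "R > 0" "cball x0 (2 * R) \<subseteq> S"
    using r by (auto simp: R_def)
  have "uniformly_continuous_on (cball x0 (2 * R)) f"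
    by (intro compact_uniformly_continuous continuous_on_subset[OF f(1)] R compact_cball)
  moreover have "e / 2 * R > 0"
    using e R by simp
  ultimately obtain d where d: "d > 0"
    "\<And>x y. x \<in> cball x0 (2 * R) \<Longrightarrow> y \<in> cball x0 (2 * R) \<Longrightarrow> dist y x < d \<Longrightarrow> dist (f y) (f x) < e / 2 * R"
    unfolding uniformly_continuous_on_def by metis
  show "\<exists>d>0. \<forall>x\<in>S. dist x x0 < d \<longrightarrow> dist (pderivc f i x) (pderivc f i x0) < e"
  proof (intro exI[of _ "min d R"] conjI ballI impI)
    fix x assume x: "dist x x0 < min d R"
    have in1: "y + axis i t \<in> cball x0 (2 * R)" if "t \<in> cball 0 R" "dist y x0 \<le> R" for t y
      using that norm_triangle_ineq[of "y - x0" "axis i t"]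
      by (simp add: dist_norm norm_minus_commute algebra_simps)
    let ?g = "\<lambda>t. f (x + axis i t) - f (x0 + axis i t)"
    have D: "(?g has_field_derivative pderivc f i (x + axis i t) - pderivc f i (x0 + axis i t)) (at t)"
      if "t \<in> cball 0 R" for t
      using in1[OF that, of x] in1[OF that, of x0] x R(2)
      by (intro DERIV_diff sep_holomorphic_has_derivative[OF f(2)])
         (use R in \<open>auto simp del: mem_cball\<close>)
    have bd: "cmod (?g t) \<le> e / 2 * R" if "t \<in> cball 0 R" for t
    proof -
      have "dist (f (x + axis i t)) (f (x0 + axis i t)) < e / 2 * R"
        by (rule d(2)) (use in1[OF that] x R(1) in \<open>auto simp del: mem_cball\<close>)
      then show ?thesis
        by (simp add: dist_norm)
    qed
    have "cmod ((deriv ^^ 1) ?g 0) \<le> fact 1 * (e / 2 * R) / R ^ 1"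
    proof (rule Cauchy_inequality)
      show "?g holomorphic_on ball 0 R"
      proof (rule holomorphic_onI)
        fix t :: complex assume "t \<in> ball 0 R"
        then show "?g field_differentiable at t within ball 0 R"
          using has_field_derivative_at_within[OF D[of t]] unfolding field_differentiable_def by auto
      qed
      show "continuous_on (cball 0 R) ?g"
        by (intro continuous_at_imp_continuous_on ballI DERIV_isCont) (rule D)
      show "cmod (?g t) \<le> e / 2 * R" if "cmod (0 - t) = R" for t
        by (rule bd) (use that in simp)
    qed (rule R)
    moreover have "deriv ?g 0 = pderivc f i x - pderivc f i x0"
      using DERIV_imp_deriv[OF D[of 0]] R by simp
    ultimately show "dist (pderivc f i x) (pderivc f i x0) < e"
      using R e by (simp add: dist_norm)
  qed (use d R in auto)
qed

text \<open>The increment of \<open>f\<close> is telescoped one coordinate at a time.\<close>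

lemma coordinate_increment_bound:
  fixes x v :: "complex ^ 'n"
  assumes f: "sep_holomorphic f S"
    and B: "\<And>y. norm (y - x) \<le> norm v \<Longrightarrow> y \<in> S"
    and D: "\<And>y i. norm (y - x) \<le> norm v \<Longrightarrow> cmod (pderivc f i y - D i) \<le> e"
  shows "cmod (f (x + v) - f x - (\<Sum>i\<in>UNIV. v $ i * D i)) \<le> e * (\<Sum>i\<in>UNIV. cmod (v $ i))"
proof -
  let ?p = "\<lambda>I. (\<chi> i. if i \<in> I then v $ i else 0) :: complex ^ 'n"
  have "cmod (f (x + ?p I) - f x - (\<Sum>i\<in>I. v $ i * D i)) \<le> e * (\<Sum>i\<in>I. cmod (v $ i))" for I
    using finite[of I]
  proof (induction I rule: finite_induct)
    case empty
    have "?p {} = 0"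
      by (simp add: vec_eq_iff)
    then show ?case
      by simp
  next
    case (insert j I)
    define y where "y = x + ?p I"
    \<comment> \<open>Each coordinate of the displacement is at most that of \<open>v\<close> in
      modulus, so the intermediate points never leave the ball on which the hypotheses hold.\<close>
    have near: "norm (y + axis j t - x) \<le> norm v" if "cmod t \<le> cmod (v $ j)" for t
      unfolding y_def
      by (rule norm_le_componentwise_cart) (use that insert.hyps in \<open>auto simp: axis_def\<close>)
    let ?h = "\<lambda>t. f (y + axis j t) - t * D j"
    have "cmod (?h (v $ j) - ?h 0) \<le> e * cmod (v $ j - 0)"
    proof (rule field_differentiable_bound)
      show "convex (cball 0 (cmod (v $ j)) :: complex set)"
        by (rule convex_cball)
      fix t :: complex assume "t \<in> cball 0 (cmod (v $ j))"
      then have t: "cmod t \<le> cmod (v $ j)"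
        by simp
      have "((\<lambda>t. f (y + axis j t)) has_field_derivative pderivc f j (y + axis j t)) (at t)"
        by (rule sep_holomorphic_has_derivative[OF f B[OF near[OF t]]])
      then have "(?h has_field_derivative pderivc f j (y + axis j t) - D j) (at t)"
        by (auto intro!: derivative_eq_intros)
      then show "(?h has_field_derivative pderivc f j (y + axis j t) - D j) (at t within cball 0 (cmod (v $ j)))"
        by (rule has_field_derivative_at_within)
      show "cmod (pderivc f j (y + axis j t) - D j) \<le> e"
        by (rule D[OF near[OF t]])
    qed auto
    moreover have "y + axis j (v $ j) = x + ?p (insert j I)"
      using insert.hyps by (auto simp: y_def vec_eq_iff axis_def)
    ultimately have *: "cmod (f (x + ?p (insert j I)) - f y - v $ j * D j) \<le> e * cmod (v $ j)"
      by (simp add: algebra_simps)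
    have eq: "f (x + ?p (insert j I)) - f x - (\<Sum>i\<in>insert j I. v $ i * D i)
        = (f (x + ?p (insert j I)) - f y - v $ j * D j) + (f y - f x - (\<Sum>i\<in>I. v $ i * D i))"
      using insert.hyps by simp
    have "cmod (f (x + ?p (insert j I)) - f x - (\<Sum>i\<in>insert j I. v $ i * D i))
        \<le> e * cmod (v $ j) + e * (\<Sum>i\<in>I. cmod (v $ i))"
      unfolding eq by (rule norm_triangle_mono[OF * insert.IH[folded y_def]])
    then show ?case
      using insert.hyps by (simp add: distrib_left)
  qed
  from this[of UNIV] show ?thesis
    by simp
qed

text \<open>By continuity the partial derivatives differ little from their values at
  \<open>x\<close> nearby, which makes the telescoped increment linear up to a small error.\<close>

lemma Osgood_has_derivative:
  fixes f :: "complex ^ 'n \<Rightarrow> complex"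
  assumes S: "open S" and f: "continuous_on S f" "sep_holomorphic f S" and x: "x \<in> S"
  shows "(f has_derivative (\<lambda>v. \<Sum>i\<in>UNIV. v $ i * pderivc f i x)) (at x)"
  unfolding has_derivative_at_alt
proof (intro conjI allI impI)
  show "bounded_linear (\<lambda>v. \<Sum>i\<in>UNIV. v $ i * pderivc f i x)"
    by (intro bounded_linear_sum bounded_linear_mult_const bounded_linear_vec_nth)
  fix e :: real assume e: "e > 0"
  \<comment> \<open>The telescoped bound involves the sum of the coordinate moduli, which is at most
    \<open>CARD('n')\<close> times the norm.\<close>
  define e' where "e' = e / CARD('n)"
  have e': "e' > 0"
    using e by (simp add: e'_def)
  have "\<forall>\<^sub>F y in nhds x. cmod (pderivc f i y - pderivc f i x) < e'" for i
  proof -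
    have "isCont (pderivc f i) x"
      using pderivc_continuous[OF S f] S x continuous_on_eq_continuous_at by blast
    then have "(pderivc f i \<longlongrightarrow> pderivc f i x) (nhds x)"
      by (simp add: isCont_def tendsto_at_iff_tendsto_nhds)
    then show ?thesis
      using e' by (simp add: tendsto_iff dist_norm)
  qed
  then have "\<forall>\<^sub>F y in nhds x. \<forall>i. cmod (pderivc f i y - pderivc f i x) < e'"
    by (rule eventually_all_finite)
  moreover have "\<forall>\<^sub>F y in nhds x. y \<in> S"
    using S x by (rule eventually_nhds_in_open)
  ultimately have "\<forall>\<^sub>F y in nhds x. y \<in> S \<and> (\<forall>i. cmod (pderivc f i y - pderivc f i x) < e')"
    by (rule eventually_conj[rotated])
  then obtain d where d: "d > 0"
    "\<And>y. dist y x < d \<Longrightarrow> y \<in> S \<and> (\<forall>i. cmod (pderivc f i y - pderivc f i x) < e')"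
    unfolding eventually_nhds_metric by blast
  show "\<exists>d>0. \<forall>y. norm (y - x) < d \<longrightarrow>
      norm (f y - f x - (\<Sum>i\<in>UNIV. (y - x) $ i * pderivc f i x)) \<le> e * norm (y - x)"
  proof (intro exI[of _ d] conjI d allI impI)
    fix y assume y: "norm (y - x) < d"
    have "cmod (f (x + (y - x)) - f x - (\<Sum>i\<in>UNIV. (y - x) $ i * pderivc f i x))
        \<le> e' * (\<Sum>i\<in>UNIV. cmod ((y - x) $ i))"
    proof (rule coordinate_increment_bound[OF f(2)])
      fix w assume "norm (w - x) \<le> norm (y - x)"
      then have "dist w x < d"
        using y by (simp add: dist_norm)
      from d(2)[OF this] show "w \<in> S" "cmod (pderivc f i w - pderivc f i x) \<le> e'" for i
        by (auto intro: less_imp_le)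
    qed
    also have "\<dots> \<le> e' * (\<Sum>i\<in>(UNIV :: 'n set). norm (y - x))"
      using e' by (intro mult_left_mono sum_mono Finite_Cartesian_Product.norm_nth_le) simp
    finally show "norm (f y - f x - (\<Sum>i\<in>UNIV. (y - x) $ i * pderivc f i x)) \<le> e * norm (y - x)"
      by (simp add: e'_def)
  qed
qed

theorem Osgood_holomorphic:
  fixes f :: "complex ^ 'n \<Rightarrow> complex"
  assumes "open S" "continuous_on S f" "sep_holomorphic f S"
  shows "holomorphic_fun f S"
  unfolding holomorphic_fun_def
proof
  fix x assume "x \<in> S"
  show "\<exists>f'. (f has_derivative f') (at x within S) \<and> (\<forall>c v. f' (c *s v) = c * f' v)"
    by (rule exI, rule conjI, rule has_derivative_at_withinI,
        rule Osgood_has_derivative[OF assms \<open>x \<in> S\<close>])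
       (simp add: sum_distrib_left mult_ac)
qed

section \<open>Differentials, chain rules and restriction to curves\<close>

lemma holomorphic_fun_at:
  assumes "holomorphic_fun f S" "open S" "x \<in> S"
  obtains f' where "(f has_derivative f') (at x)" "\<And>c v. f' (c *s v) = c * f' v"
  using assms unfolding holomorphic_fun_def by (metis at_within_open)

lemma holomorphic_fun_continuous: "holomorphic_fun f S \<Longrightarrow> continuous_on S f"
  unfolding holomorphic_fun_def continuous_on_eq_continuous_within
  using has_derivative_continuous by blast

lemma has_derivative_vecI:
  fixes f :: "'a :: euclidean_space \<Rightarrow> complex ^ 'n"
  assumes "\<And>j. ((\<lambda>x. f x $ j) has_derivative (\<lambda>v. f' v $ j)) (at x)"
  shows "(f has_derivative f') (at x)"
  unfolding has_derivative_at
proof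
  have "linear (\<lambda>v. f' v $ j)" for j
    using assms[of j] has_derivative_linear by blast
  then show "bounded_linear f'"
    unfolding linear_conv_bounded_linear[symmetric]
    by (auto simp: linear_iff vec_eq_iff)
  have "(\<lambda>h. (f (x + h) - f x - f' h) /\<^sub>R norm h) \<midarrow>0\<rightarrow> 0"
  proof (rule vec_tendstoI)
    fix j
    have "(\<lambda>h. norm (f (x + h) $ j - f x $ j - f' h $ j) / norm h) \<midarrow>0\<rightarrow> 0"
      using assms[of j] unfolding has_derivative_at by simp
    then have "(\<lambda>h. norm ((f (x + h) $ j - f x $ j - f' h $ j) /\<^sub>R norm h)) \<midarrow>0\<rightarrow> 0"
      by (simp add: divide_inverse mult.commute)
    then show "(\<lambda>h. ((f (x + h) - f x - f' h) /\<^sub>R norm h) $ j) \<midarrow>0\<rightarrow> 0 $ j"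
      by (simp add: tendsto_norm_zero_cancel)
  qed
  then have "(\<lambda>h. norm ((f (x + h) - f x - f' h) /\<^sub>R norm h)) \<midarrow>0\<rightarrow> 0"
    by (rule tendsto_norm_zero)
  then show "(\<lambda>h. norm (f (x + h) - f x - f' h) / norm h) \<midarrow>0\<rightarrow> 0"
    by (simp add: divide_inverse mult.commute)
qed

lemma has_derivative_curve:
  fixes c :: "complex \<Rightarrow> complex ^ 'n"
  assumes "\<And>i. ((\<lambda>t. c t $ i) has_field_derivative u $ i) (at t)"
  shows "(c has_derivative (\<lambda>s. s *s u)) (at t)"
  using assms by (intro has_derivative_vecI) (simp add: has_field_derivative_def mult.commute[of _ "u $ _"] mult_commute_abs)

lemma has_field_derivative_fun_curve:
  fixes c :: "complex \<Rightarrow> complex ^ 'n"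
  assumes f: "(f has_derivative f') (at (c t))" "\<And>k v. f' (k *s v) = k * f' v"
    and c: "\<And>i. ((\<lambda>t. c t $ i) has_field_derivative u $ i) (at t)"
  shows "((\<lambda>t. f (c t)) has_field_derivative f' u) (at t)"
proof -
  have "((\<lambda>t. f (c t)) has_derivative (\<lambda>s. f' (s *s u))) (at t)"
    by (rule has_derivative_compose[OF has_derivative_curve[OF c] f(1)])
  moreover have "(\<lambda>s. f' (s *s u)) = (*) (f' u)"
    by (auto simp: f(2))
  ultimately show ?thesis
    by (simp add: has_field_derivative_def)
qed

lemma holomorphic_fun_curve:
  assumes f: "holomorphic_fun f S" "open S" and c: "holomorphic_curve c T" "open T" "c ` T \<subseteq> S"
  shows "(\<lambda>t. f (c t)) holomorphic_on T"
proof (rule holomorphic_onI)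
  fix t assume t: "t \<in> T"
  obtain f' where f': "(f has_derivative f') (at (c t))" "\<And>k v. f' (k *s v) = k * f' v"
    using holomorphic_fun_at[OF f, of "c t"] c(3) t by blast
  have "((\<lambda>t. f (c t)) has_field_derivative f' (\<chi> i. deriv (\<lambda>t. c t $ i) t)) (at t)"
    by (rule has_field_derivative_fun_curve[where c = c, OF f'])
       (use c t in \<open>auto simp: holomorphic_curve_def intro: holomorphic_derivI\<close>)
  then show "(\<lambda>t. f (c t)) field_differentiable (at t within T)"
    using field_differentiable_at_within field_differentiable_def by blast
qed

lemma has_field_derivative_axis:
  "((\<lambda>t. (x + axis i t :: complex ^ 'n) $ j) has_field_derivative axis i 1 $ j) (at t within A)"
  by (auto simp: axis_def intro!: derivative_eq_intros)

lemma holomorphic_fun_imp_sep: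
  assumes "holomorphic_fun f S" "open S"
  shows "sep_holomorphic f S"
  unfolding sep_holomorphic_def
proof (intro ballI allI)
  fix x i assume "x \<in> S"
  obtain f' where f': "(f has_derivative f') (at x)" "\<And>c v. f' (c *s v) = c * f' v"
    using holomorphic_fun_at[OF assms \<open>x \<in> S\<close>] by metis
  have "((\<lambda>t. f (x + axis i t)) has_field_derivative f' (axis i 1)) (at 0)"
    by (rule has_field_derivative_fun_curve) (use f' has_field_derivative_axis in auto)
  then show "(\<lambda>t. f (x + axis i t)) field_differentiable at 0"
    using field_differentiable_def by blast
qed

lemma holomorphic_fun_has_derivative:
  assumes "holomorphic_fun f S" "open S" "x \<in> S"
  shows "(f has_derivative (\<lambda>v. \<Sum>i\<in>UNIV. v $ i * pderivc f i x)) (at x)"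
  using assms
  by (intro Osgood_has_derivative) (auto intro: holomorphic_fun_continuous holomorphic_fun_imp_sep)

text \<open>Along any coordinate line the partial derivative is a uniform limit of difference
  quotients in direction \<open>i\<close>, each holomorphic in the parameter; Osgood's lemma then
  applies to the partial derivative itself.\<close>

theorem holomorphic_fun_pderivc:
  fixes f :: "complex ^ 'n \<Rightarrow> complex"
  assumes f: "holomorphic_fun f S" "open S"
  shows "holomorphic_fun (pderivc f i) S"
proof (rule Osgood_holomorphic)
  have sep: "sep_holomorphic f S"
    by (rule holomorphic_fun_imp_sep[OF f])
  have cf: "continuous_on S f"
    by (rule holomorphic_fun_continuous[OF f(1)])
  show cD: "continuous_on S (pderivc f i)"
    by (rule pderivc_continuous[OF f(2) cf sep])
  show "sep_holomorphic (pderivc f i) S"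
    unfolding sep_holomorphic_def
  proof (intro ballI allI)
    fix x j assume "x \<in> S"
    obtain r where r: "r > 0" "cball x r \<subseteq> S"
      using f(2) \<open>x \<in> S\<close> open_contains_cball by blast
    define R where "R = r / 2"
    have R: "R > 0" "cball x (2 * R) \<subseteq> S"
      using r by (auto simp: R_def)
    define s where "s n = R / Suc n" for n :: nat
    have s: "s n > 0" "s n \<le> R" for n
      using R(1) by (simp_all add: s_def field_simps)
    have s0: "s \<longlonglongrightarrow> 0"
      unfolding s_def using tendsto_mult[OF tendsto_const[of R] LIMSEQ_inverse_real_of_nat]
      by (simp add: divide_inverse)
    have in1: "x + axis j t + axis i w \<in> cball x (2 * R)" if "cmod t \<le> R" "cmod w \<le> R" for t w
    proof -
      have "dist (x + axis j t + axis i w) x = norm (axis j t + axis i w :: complex ^ 'n)"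
        by (simp add: dist_norm)
      then show ?thesis
        using that norm_triangle_ineq[of "axis j t" "axis i w :: complex ^ 'n"]
        by (simp add: dist_commute)
    qed
    have hol: "(\<lambda>t. f (x + axis j t + v)) holomorphic_on A"
      if "\<And>t. t \<in> A \<Longrightarrow> x + axis j t + v \<in> S" for v A
    proof (rule holomorphic_onI)
      fix t assume "t \<in> A"
      have "((\<lambda>t. f ((x + v) + axis j t)) has_field_derivative pderivc f j ((x + v) + axis j t)) (at t)"
        by (rule sep_holomorphic_has_derivative[OF sep]) (use that[OF \<open>t \<in> A\<close>] in \<open>simp add: add_ac\<close>)
      then show "(\<lambda>t. f (x + axis j t + v)) field_differentiable at t within A"
        by (auto simp: field_differentiable_def add_ac intro: has_field_derivative_at_within)
    qed
    let ?g = "\<lambda>n t. (f (x + axis j t + axis i (of_real (s n))) - f (x + axis j t)) / of_real (s n)"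
    have g: "?g n holomorphic_on cball 0 R" for n
      using s(1)[of n] in1 R s(2)[of n] in1[where w = 0]
      by (intro holomorphic_intros hol hol[where v = 0, simplified]) (auto simp: subset_eq)
    have ulim: "uniform_limit (cball 0 R) ?g (\<lambda>t. pderivc f i (x + axis j t)) sequentially"
      unfolding uniform_limit_iff
    proof (intro allI impI)
      fix e :: real assume e: "e > 0"
      have "uniformly_continuous_on (cball x (2 * R)) (pderivc f i)"
        by (intro compact_uniformly_continuous continuous_on_subset[OF cD] R compact_cball)
      then obtain d where d: "d > 0"
        "\<And>y y'. y \<in> cball x (2 * R) \<Longrightarrow> y' \<in> cball x (2 * R) \<Longrightarrow> dist y' y < d \<Longrightarrow>
           dist (pderivc f i y') (pderivc f i y) < e / 2"
        using e unfolding uniformly_continuous_on_def by (meson half_gt_zero)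
      have "\<forall>\<^sub>F n in sequentially. s n < d"
        using order_tendstoD(2)[OF s0] d(1) by simp
      then show "\<forall>\<^sub>F n in sequentially. \<forall>t\<in>cball 0 R. dist (?g n t) (pderivc f i (x + axis j t)) < e"
      proof eventually_elim
        fix n assume sd: "s n < d"
        show "\<forall>t\<in>cball 0 R. dist (?g n t) (pderivc f i (x + axis j t)) < e"
        proof
          fix t :: complex assume t: "t \<in> cball 0 R"
          define y where "y = x + axis j t"
          \<comment> \<open>With the linear term subtracted, the derivative is at most e/2 near 0,
            and the mean value inequality bounds the error of the difference quotient.\<close>
          let ?h = "\<lambda>w. f (y + axis i w) - w * pderivc f i y"
          have "cmod (?h (of_real (s n)) - ?h 0) \<le> e / 2 * cmod (of_real (s n) - 0)"
          proof (rule field_differentiable_bound)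
            show "convex (cball 0 (s n) :: complex set)"
              by (rule convex_cball)
            fix w :: complex assume w: "w \<in> cball 0 (s n)"
            have yw: "y + axis i w \<in> cball x (2 * R)" "y \<in> cball x (2 * R)"
              using in1[of t w] in1[of t 0] t w s[of n] R(1) by (simp_all add: y_def)
            have "((\<lambda>w. f (y + axis i w)) has_field_derivative pderivc f i (y + axis i w)) (at w)"
              by (rule sep_holomorphic_has_derivative[OF sep]) (use yw R in blast)
            then have "(?h has_field_derivative pderivc f i (y + axis i w) - pderivc f i y) (at w)"
              by (auto intro!: derivative_eq_intros)
            then show "(?h has_field_derivative pderivc f i (y + axis i w) - pderivc f i y)
                (at w within cball 0 (s n))"
              by (rule has_field_derivative_at_within)
            have "dist (y + axis i w) y < d"
              using w sd by (simp add: dist_norm)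
            then show "cmod (pderivc f i (y + axis i w) - pderivc f i y) \<le> e / 2"
              using d(2)[OF yw(2,1)] by (simp add: dist_norm)
          qed (use s[of n] in auto)
          then have "cmod (f (y + axis i (of_real (s n))) - f y - of_real (s n) * pderivc f i y) \<le> e / 2 * s n"
            using s(1)[of n] by (simp add: algebra_simps)
          moreover have "?g n t - pderivc f i y =
              (f (y + axis i (of_real (s n))) - f y - of_real (s n) * pderivc f i y) / of_real (s n)"
            using s(1)[of n] by (simp add: y_def field_simps)
          ultimately have "cmod (?g n t - pderivc f i y) \<le> e / 2"
            using s(1)[of n] by (simp add: norm_divide divide_le_eq)
          then show "dist (?g n t) (pderivc f i (x + axis j t)) < e"
            using e by (simp add: dist_norm y_def)
        qed
      qed
    qed
    have cg: "\<forall>\<^sub>F n in sequentially. continuous_on (cball 0 R) (?g n) \<and> ?g n holomorphic_on ball 0 R"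
      by (intro always_eventually allI conjI holomorphic_on_imp_continuous_on g
          holomorphic_on_subset[OF g ball_subset_cball])
    from cg ulim have "(\<lambda>t. pderivc f i (x + axis j t)) holomorphic_on ball 0 R"
      by (rule holomorphic_uniform_limit) simp_all
    then show "(\<lambda>t. pderivc f i (x + axis j t)) field_differentiable at 0"
      using R(1) by (simp add: holomorphic_on_imp_differentiable_at)
  qed
qed (rule f)

section \<open>The inverse of an injective holomorphic map\<close>

definition cjacobian :: "(complex ^ 'n \<Rightarrow> complex ^ 'm) \<Rightarrow> complex ^ 'n \<Rightarrow> complex ^ 'n ^ 'm" where
  "cjacobian f x = (\<chi> j i. pderivc (\<lambda>x. f x $ j) i x)"

lemma holomorphic_map_has_derivative:
  assumes "holomorphic_map f S" "open S" "x \<in> S"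
  shows "(f has_derivative (\<lambda>v. cjacobian f x *v v)) (at x)"
proof (rule has_derivative_vecI)
  fix j
  have "((\<lambda>x. f x $ j) has_derivative (\<lambda>v. \<Sum>i\<in>UNIV. v $ i * pderivc (\<lambda>x. f x $ j) i x)) (at x)"
    using assms by (intro holomorphic_fun_has_derivative) (auto simp: holomorphic_map_def)
  then show "((\<lambda>x. f x $ j) has_derivative (\<lambda>v. (cjacobian f x *v v) $ j)) (at x)"
    by (simp add: cjacobian_def matrix_vector_mult_def mult.commute)
qed

lemma holomorphic_map_continuous: "holomorphic_map f S \<Longrightarrow> continuous_on S f"
  unfolding holomorphic_map_def
  using continuous_on_vec_lambda[of S "\<lambda>i x. f x $ i"] by (simp add: holomorphic_fun_continuous)

lemma continuous_on_det_cjacobian: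
  fixes f :: "complex ^ 'n \<Rightarrow> complex ^ 'n"
  assumes "holomorphic_map f S" "open S"
  shows "continuous_on S (\<lambda>x. det (cjacobian f x))"
  unfolding det_def cjacobian_def vec_lambda_beta using assms
  by (intro continuous_on_sum continuous_on_mult continuous_on_const continuous_on_prod,
      intro holomorphic_fun_continuous holomorphic_fun_pderivc) (auto simp: holomorphic_map_def)

lemma holomorphic_det_cjacobian_curve:
  fixes f :: "complex ^ 'n \<Rightarrow> complex ^ 'n"
  assumes "holomorphic_map f S" "open S" "holomorphic_curve c T" "open T" "c ` T \<subseteq> S"
  shows "(\<lambda>t. det (cjacobian f (c t))) holomorphic_on T"
  unfolding det_def cjacobian_def using assms
  by (auto simp: holomorphic_map_def intro!: holomorphic_intros holomorphic_fun_curve[of _ S]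
      holomorphic_fun_pderivc)

text \<open>The derivative is produced as a complex matrix, so that its complex linearity is visible
  to later steps.\<close>

lemma inverse_has_derivative:
  fixes f :: "complex ^ 'n \<Rightarrow> complex ^ 'n"
  assumes f: "holomorphic_map f S" "open S" "x \<in> S" and h: "\<And>x. x \<in> S \<Longrightarrow> h (f x) = x"
    and "det (cjacobian f x) \<noteq> 0"
  obtains B where "(h has_derivative (\<lambda>v. B *v v)) (at (f x))"
proof -
  obtain B where B: "cjacobian f x ** B = mat 1"
    using assms(5) invertible_det_nz[of "cjacobian f x"] invertible_def by blast
  have "(h has_derivative (\<lambda>v. B *v v)) (at (f x))"
    by (rule has_derivative_inverse_strong[OF f(2,3) holomorphic_map_continuous[OF f(1)] h
          holomorphic_map_has_derivative[OF f]])
       (auto simp: fun_eq_iff matrix_vector_mul_assoc B)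
  then show ?thesis
    by (rule that)
qed

text \<open>Sard's theorem is available for square real matrices whose index type is well-ordered;
  \<open>'n bit0\<close> is such a type with twice as many elements as \<open>'n\<close>.\<close>

lemma regular_points_dense:
  fixes f :: "complex ^ 'n \<Rightarrow> complex ^ 'n"
  assumes f: "holomorphic_map f S" "open S" "inj_on f S" and W: "open W" "W \<subseteq> S" "W \<noteq> {}"
  shows "\<exists>x\<in>W. det (cjacobian f x) \<noteq> 0"
proof (rule ccontr)
  assume "\<not> ?thesis"
  then have sing: "det (cjacobian f x) = 0" if "x \<in> W" for x
    using that by blast
  have "DIM(complex ^ 'n) = DIM(real ^ ('n bit0))"
    by simp
  then obtain T :: "complex ^ 'n \<Rightarrow> real ^ ('n bit0)" and T' where
    T: "linear T" "linear T'" "\<And>x. T' (T x) = x" "\<And>y. T (T' y) = y"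
    using isomorphisms_UNIV_UNIV by metis
  have bT: "bounded_linear T" "bounded_linear T'"
    using T(1,2) linear_conv_bounded_linear by blast+
  \<comment> \<open>If the Jacobian vanished on all of \<open>W\<close>, Sard would make the image
    of \<open>W\<close> negligible, whereas invariance of domain makes it open and nonempty.\<close>
  have "negligible ((\<lambda>y. T (f (T' y))) ` (T ` W))"
  proof (rule baby_Sard[where f' = "\<lambda>y v. T (cjacobian f (T' y) *v T' v)"])
    fix y assume "y \<in> T ` W"
    then have y: "T' y \<in> W" "T' y \<in> S"
      using T(3) W(2) by auto
    have D: "((\<lambda>y. T (f (T' y))) has_derivative (\<lambda>v. T (cjacobian f (T' y) *v T' v))) (at y)"
      by (intro bounded_linear.has_derivative[OF bT(1)] has_derivative_compose[of T' T' y UNIV f]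
          bounded_linear_imp_has_derivative[OF bT(2)] holomorphic_map_has_derivative[OF f(1,2) y(2)])
    then show "((\<lambda>y. T (f (T' y))) has_derivative (\<lambda>v. T (cjacobian f (T' y) *v T' v))) (at y within T ` W)"
      by (rule has_derivative_at_withinI)
    let ?F = "\<lambda>v. T (cjacobian f (T' y) *v T' v)"
    have lin: "linear ?F"
      using D has_derivative_linear by blast
    \<comment> \<open>A complex kernel vector is also a real one, so the corresponding real matrix
      is not injective and has deficient rank.\<close>
    obtain v where v: "v \<noteq> 0" "cjacobian f (T' y) *v v = 0"
      using sing[OF y(1)] invertible_det_nz[of "cjacobian f (T' y)"]
        invertible_left_inverse[of "cjacobian f (T' y)"]
        matrix_left_invertible_ker[of "cjacobian f (T' y)"] by blast
    have "?F (T v) = ?F 0"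
      using v(2) T(3) linear_0[OF T(2)] by simp
    moreover have "T v \<noteq> 0"
      using v(1) T(3)[of v] linear_0[OF T(2)] by metis
    ultimately have "\<not> inj ?F"
      by (auto dest: injD)
    moreover have "(*v) (matrix ?F) = ?F"
      by (rule matrix_vector_mul(2)[OF lin])
    ultimately show "rank (matrix ?F) < CARD('n bit0)"
      using less_rank_noninjective[of "matrix ?F"] by metis
  qed simp
  moreover have "(\<lambda>y. T (f (T' y))) ` (T ` W) = T ` (f ` W)"
    using T(3) by (auto simp: image_image)
  moreover have "open (f ` W)"
    using invariance_of_domain[of W f] W f inj_on_subset
      continuous_on_subset[OF holomorphic_map_continuous[OF f(1)]] by blast
  then have "open (T ` (f ` W))"
    by (rule open_surjective_linear_image[OF _ T(1)]) (metis T(4) surjI)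
  ultimately show False
    using open_not_negligible[of "T ` (f ` W)"] W(3) by auto
qed

theorem holomorphic_inverse:
  fixes f :: "complex ^ 'n \<Rightarrow> complex ^ 'n"
  assumes f: "holomorphic_map f S" "open S" "inj_on f S"
  shows "open (f ` S)" "holomorphic_map (inv_into S f) (f ` S)"
proof -
  let ?h = "inv_into S f"
  define Y where "Y = f ` S"
  have cf: "continuous_on S f"
    by (rule holomorphic_map_continuous[OF f(1)])
  have oY: "open Y"
    unfolding Y_def by (rule invariance_of_domain[OF cf f(2,3)])
  then show "open (f ` S)"
    by (simp add: Y_def)
  have hf: "?h (f x) = x" if "x \<in> S" for x
    using f(3) that by simp
  have hY: "?h y \<in> S" "f (?h y) = y" if "y \<in> Y" for y
    using that by (auto simp: Y_def inv_into_into f_inv_into_f)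
  obtain g where g: "homeomorphism S Y f g"
    using invariance_of_domain_homeomorphism[OF f(2) cf _ f(3)] by (auto simp: Y_def)
  have "g y = ?h y" if "y \<in> Y" for y
    using homeomorphism_apply1[OF g hY(1)[OF that]] hY(2)[OF that] by simp
  then have ch: "continuous_on Y ?h"
    using homeomorphism_cont2[OF g] by (metis continuous_on_cong)
  define J where "J y = det (cjacobian f (?h y))" for y
  have cJ: "continuous_on Y J"
    unfolding J_def
    by (rule continuous_on_compose2[OF continuous_on_det_cjacobian[OF f(1,2)] ch]) (use hY in auto)
  \<comment> \<open>\<open>J y \<noteq> 0\<close> at the base point provides the nonempty set on
    which Rado's theorem relies.\<close>
  have line: "(\<lambda>t. ?h (y + axis i t) $ j) holomorphic_on ball 0 R"
    if R: "\<And>t. t \<in> cball 0 R \<Longrightarrow> y + axis i t \<in> Y" and J0: "J y \<noteq> 0" and "R > 0" for y i j R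
  proof -
    let ?c = "\<lambda>t. y + axis i t" and ?V = "{t \<in> ball 0 R. J (y + axis i t) \<noteq> 0}"
    have cc: "continuous_on (cball 0 R) ?c"
      by (intro continuous_intros)
    have cu: "continuous_on (cball 0 R) (\<lambda>t. J (?c t))"
      by (rule continuous_on_compose2[OF cJ cc]) (use R in auto)
    have ck: "continuous_on (cball 0 R) (\<lambda>t. ?h (?c t))"
      by (rule continuous_on_compose2[OF ch cc]) (use R in auto)
    have oV: "open ?V"
      by (rule open_nonzero_ball[OF cu])
    have hol: "(\<lambda>t. ?h (?c t) $ k) holomorphic_on ?V" for k
    proof (rule holomorphic_onI)
      fix t assume t: "t \<in> ?V"
      then have cY: "?c t \<in> Y"
        using R[of t] by simp
      obtain B where "(?h has_derivative (\<lambda>v. B *v v)) (at (f (?h (?c t))))"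
        using inverse_has_derivative[OF f(1,2) hY(1)[OF cY] hf] t unfolding J_def by blast
      then have "((\<lambda>x. ?h x $ k) has_derivative (\<lambda>v. (B *v v) $ k)) (at (?c t))"
        unfolding hY(2)[OF cY] by (rule bounded_linear.has_derivative[OF bounded_linear_vec_nth])
      then have "((\<lambda>t. ?h (?c t) $ k) has_field_derivative (B *v axis i 1) $ k) (at t)"
        by (rule has_field_derivative_fun_curve[where c = ?c, OF _ _ has_field_derivative_axis])
           (simp add: vector_scalar_commute)
      then show "(\<lambda>t. ?h (?c t) $ k) field_differentiable at t within ?V"
        using field_differentiable_def field_differentiable_at_within by blast
    qed
    show ?thesis
    proof (rule Rado[OF cu])
      \<comment> \<open>On \<open>?V\<close> the curve \<open>?h\<close> after \<open>?c\<close> is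
        already known to be holomorphic, and so is the Jacobian along it.\<close>
      show "(\<lambda>t. J (?c t)) holomorphic_on ?V"
        unfolding J_def
        by (rule holomorphic_det_cjacobian_curve[OF f(1,2) _ oV[unfolded J_def]])
           (use hol R hY in \<open>auto simp: holomorphic_curve_def J_def\<close>)
      show "?V \<noteq> {}"
        using J0 \<open>R > 0\<close> by (auto intro!: exI[of _ 0])
      show "continuous_on (cball 0 R) (\<lambda>t. ?h (?c t) $ j)"
        by (intro continuous_intros ck)
    qed (rule hol)
  qed
  \<comment> \<open>Density is carried from \<open>S\<close> to \<open>Y\<close> by pulling the ball
    about \<open>y\<close> back along \<open>f\<close>.\<close>
  have regular: "\<exists>y'. y' \<in> Y \<and> dist y' y < e \<and> J y' \<noteq> 0" if y: "y \<in> Y" and e: "e > 0" for y e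
  proof -
    define W where "W = S \<inter> f -` ball y e"
    have "open W"
      unfolding W_def by (rule continuous_open_preimage[OF cf f(2) open_ball])
    moreover have "?h y \<in> W"
      using hY[OF y] e by (simp add: W_def)
    ultimately obtain x where x: "x \<in> W" "det (cjacobian f x) \<noteq> 0"
      using regular_points_dense[OF f, of W] unfolding W_def by blast
    then show ?thesis
      by (intro exI[of _ "f x"]) (auto simp: W_def J_def Y_def hf dist_commute f(3))
  qed
  have "holomorphic_fun (\<lambda>y. ?h y $ j) Y" for j
  proof (rule Osgood_holomorphic[OF oY])
    show chj: "continuous_on Y (\<lambda>y. ?h y $ j)"
      by (intro continuous_intros ch)
    show "sep_holomorphic (\<lambda>y. ?h y $ j) Y"
      unfolding sep_holomorphic_def
    proof (intro ballI allI)
      fix y i assume y: "y \<in> Y"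
      obtain r where r: "r > 0" "cball y r \<subseteq> Y"
        using oY y open_contains_cball by blast
      define R where "R = r / 2"
      have R: "R > 0" "cball y (2 * R) \<subseteq> Y"
        using r by (auto simp: R_def)
      \<comment> \<open>The bound \<open>R\<close> keeps a disc of radius \<open>R\<close> on every
        displaced line inside the compact ball; the bound \<open>1 / Suc n\<close> makes these lines
        converge to the one through \<open>y\<close>.\<close>
      have "\<forall>n. \<exists>y'. y' \<in> Y \<and> dist y' y < min R (1 / Suc n) \<and> J y' \<noteq> 0"
        by (intro allI regular[OF y]) (use R(1) in simp)
      then obtain z where z: "\<And>n. z n \<in> Y" "\<And>n. dist (z n) y < min R (1 / Suc n)" "\<And>n. J (z n) \<noteq> 0"
        by metis
      have in1: "w + axis i t \<in> cball y (2 * R)" if "dist w y \<le> R" "cmod t \<le> R" for w t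
        using that norm_triangle_ineq[of "w - y" "axis i t"]
        by (simp add: dist_norm norm_minus_commute algebra_simps)
      let ?g = "\<lambda>n t. ?h (z n + axis i t) $ j"
      have inz: "z n + axis i t \<in> cball y (2 * R)" if "t \<in> cball 0 R" for n t
        using in1[of "z n" t] z(2)[of n] that by (simp add: less_imp_le)
      have "continuous_on (cball 0 R) (?g n)" for n
        by (rule continuous_on_compose2[OF chj]) (use inz R in \<open>auto intro!: continuous_intros\<close>)
      moreover have "?g n holomorphic_on ball 0 R" for n
        by (rule line[OF _ z(3) R(1)]) (use inz R in blast)
      ultimately have cg: "\<forall>\<^sub>F n in sequentially. continuous_on (cball 0 R) (?g n) \<and> ?g n holomorphic_on ball 0 R"
        by simp
      have "uniform_limit (cball 0 R) ?g (\<lambda>t. ?h (y + axis i t) $ j) sequentially"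
        unfolding uniform_limit_iff
      proof (intro allI impI)
        fix e :: real assume e: "e > 0"
        have "uniformly_continuous_on (cball y (2 * R)) (\<lambda>y. ?h y $ j)"
          by (intro compact_uniformly_continuous continuous_on_subset[OF chj] R compact_cball)
        then obtain d where d: "d > 0"
          "\<And>w w'. w \<in> cball y (2 * R) \<Longrightarrow> w' \<in> cball y (2 * R) \<Longrightarrow> dist w' w < d \<Longrightarrow>
             dist (?h w' $ j) (?h w $ j) < e"
          using e unfolding uniformly_continuous_on_def by metis
        have "(\<lambda>n. 1 / real (Suc n)) \<longlonglongrightarrow> 0"
          using LIMSEQ_inverse_real_of_nat by (simp add: inverse_eq_divide)
        then have "\<forall>\<^sub>F n in sequentially. 1 / real (Suc n) < d"
          using d(1) by (rule order_tendstoD)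
        then show "\<forall>\<^sub>F n in sequentially. \<forall>t\<in>cball 0 R. dist (?g n t) (?h (y + axis i t) $ j) < e"
        proof eventually_elim
          fix n assume n: "1 / real (Suc n) < d"
          show "\<forall>t\<in>cball 0 R. dist (?g n t) (?h (y + axis i t) $ j) < e"
          proof
            fix t :: complex assume t: "t \<in> cball 0 R"
            show "dist (?g n t) (?h (y + axis i t) $ j) < e"
              by (rule d(2)) (use inz[OF t] in1[of y t] t z(2)[of n] n R(1) in auto)
          qed
        qed
      qed
      with cg have "(\<lambda>t. ?h (y + axis i t) $ j) holomorphic_on ball 0 R"
        by (rule holomorphic_uniform_limit) simp_all
      then show "(\<lambda>t. ?h (y + axis i t) $ j) field_differentiable at 0"
        using R(1) by (simp add: holomorphic_on_imp_differentiable_at)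
    qed
  qed
  then show "holomorphic_map ?h (f ` S)"
    by (simp add: holomorphic_map_def Y_def)
qed

section \<open>The invariant pseudo-distances\<close>

definition kchain ::
  "(complex ^ 'n) set \<Rightarrow> complex ^ 'n \<Rightarrow> complex ^ 'n \<Rightarrow> nat \<Rightarrow> (nat \<Rightarrow> complex) \<Rightarrow> (nat \<Rightarrow> complex) \<Rightarrow>
     (nat \<Rightarrow> complex \<Rightarrow> complex ^ 'n) \<Rightarrow> bool" where
  "kchain X z w m a b f \<longleftrightarrow> 1 \<le> m \<and>
     (\<forall>i\<in>{1..m}. a i \<in> unit_disc \<and> b i \<in> unit_disc \<and>
        holomorphic_curve (f i) unit_disc \<and> f i ` unit_disc \<subseteq> X) \<and>
     f 1 (a 1) = z \<and> (\<forall>i\<in>{1..<m}. f i (b i) = f (Suc i) (a (Suc i))) \<and> f m (b m) = w"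

lemma kobayashi_dist_eq:
  "kobayashi_dist X z w = Inf {ereal (\<Sum>i=1..m. poincare_dist (a i) (b i)) |m a b f. kchain X z w m a b f}"
  by (simp add: kobayashi_dist_def kchain_def)

lemma kobayashi_dist_le:
  "kchain X z w m a b f \<Longrightarrow> kobayashi_dist X z w \<le> ereal (\<Sum>i=1..m. poincare_dist (a i) (b i))"
  unfolding kobayashi_dist_eq by (rule Inf_lower) blast

lemma kobayashi_dist_disc:
  assumes "holomorphic_curve g unit_disc" "g ` unit_disc \<subseteq> X" "a \<in> unit_disc" "b \<in> unit_disc"
  shows "kobayashi_dist X (g a) (g b) \<le> ereal (poincare_dist a b)"
proof -
  have "kchain X (g a) (g b) 1 (\<lambda>_. a) (\<lambda>_. b) (\<lambda>_. g)"
    using assms by (simp add: kchain_def)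
  from kobayashi_dist_le[OF this] show ?thesis
    by simp
qed

text \<open>Links are numbered from 1 to \<open>m\<close>, so reversal sends \<open>i\<close> to
  \<open>Suc m - i\<close>; each disc also exchanges its two marked points.\<close>

lemma kchain_rev:
  assumes "kchain X z w m a b f"
  shows "kchain X w z m (\<lambda>i. b (Suc m - i)) (\<lambda>i. a (Suc m - i)) (\<lambda>i. f (Suc m - i))"
proof -
  have "f (Suc m - i) (a (Suc m - i)) = f (Suc m - Suc i) (b (Suc m - Suc i))" if "i \<in> {1..<m}" for i
  proof -
    have "m - i \<in> {1..<m}" "Suc (m - i) = Suc m - i"
      using that by auto
    then show ?thesis
      using assms unfolding kchain_def by (metis diff_Suc_Suc)
  qed
  moreover have "Suc m - i \<in> {1..m}" if "i \<in> {1..m}" for i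
    using that by auto
  ultimately show ?thesis
    using assms unfolding kchain_def by auto
qed

lemma kobayashi_dist_commute: "kobayashi_dist X z w = kobayashi_dist X w z"
proof -
  have "kobayashi_dist X w z \<le> kobayashi_dist X z w" for z w
    unfolding kobayashi_dist_eq[of X z w]
  proof (rule Inf_greatest, clarify)
    fix m a b f assume c: "kchain X z w m a b f"
    have "(\<Sum>i=1..m. poincare_dist (b (Suc m - i)) (a (Suc m - i))) = (\<Sum>i=1..m. poincare_dist (b i) (a i))"
      using sum.atLeastAtMost_rev[of "\<lambda>i. poincare_dist (b i) (a i)" 1 m] by simp
    also have "\<dots> = (\<Sum>i=1..m. poincare_dist (a i) (b i))"
      using c by (intro sum.cong refl poincare_dist_commute) (auto simp: kchain_def)
    finally show "kobayashi_dist X w z \<le> ereal (\<Sum>i=1..m. poincare_dist (a i) (b i))"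
      using kobayashi_dist_le[OF kchain_rev[OF c]] by simp
  qed
  then show ?thesis
    by (simp add: antisym)
qed

lemma kobayashi_dist_nonneg: "0 \<le> kobayashi_dist X z w"
  unfolding kobayashi_dist_eq
  by (rule Inf_greatest) (auto simp: kchain_def intro!: sum_nonneg poincare_dist_nonneg)

text \<open>The links after \<open>m\<close> are those of the second chain shifted by
  \<open>m\<close>; the only new matching condition is at \<open>i = m\<close>, where both sides
  equal \<open>y\<close>.\<close>

lemma kchain_append:
  assumes 1: "kchain X x y m a b f" and 2: "kchain X y z n a' b' f'"
  shows "kchain X x z (m + n) (\<lambda>i. if i \<le> m then a i else a' (i - m))
    (\<lambda>i. if i \<le> m then b i else b' (i - m)) (\<lambda>i. if i \<le> m then f i else f' (i - m))"
proof -
  have m: "1 \<le> m" "1 \<le> n"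
    using 1 2 by (auto simp: kchain_def)
  have P: "i - m \<in> {1..n}" if "i \<in> {1..m + n}" "\<not> i \<le> m" for i
    using that by auto
  have Q: "(if i \<le> m then f i else f' (i - m)) (if i \<le> m then b i else b' (i - m)) =
      (if Suc i \<le> m then f (Suc i) else f' (Suc i - m)) (if Suc i \<le> m then a (Suc i) else a' (Suc i - m))"
    if i: "i \<in> {1..<m + n}" for i
  proof -
    consider "i < m" | "i = m" | "i > m"
      by linarith
    then show ?thesis
    proof cases
      case 1
      then show ?thesis
        using assms(1) i by (auto simp: kchain_def)
    next
      case 2
      then show ?thesis
        using assms by (simp add: kchain_def)
    next
      case 3
      then have "i - m \<in> {1..<n}" "Suc i - m = Suc (i - m)"
        using i by auto
      then show ?thesis
        using assms(2) 3 by (auto simp: kchain_def)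
    qed
  qed
  show ?thesis
    unfolding kchain_def
  proof (intro conjI ballI)
    fix i assume i: "i \<in> {1..m + n}"
    show "(if i \<le> m then a i else a' (i - m)) \<in> unit_disc"
      "(if i \<le> m then b i else b' (i - m)) \<in> unit_disc"
      "holomorphic_curve (if i \<le> m then f i else f' (i - m)) unit_disc"
      "(if i \<le> m then f i else f' (i - m)) ` unit_disc \<subseteq> X"
      using 1 2 P[OF i] i by (auto simp: kchain_def)
  qed (use 1 2 m Q in \<open>auto simp: kchain_def\<close>)
qed

lemma kobayashi_dist_triangle:
  "kobayashi_dist X x z \<le> kobayashi_dist X x y + kobayashi_dist X y z"
proof -
  have *: "kobayashi_dist X x z \<le> ereal L1 + ereal L2"
    if 1: "kchain X x y m a b f" "L1 = (\<Sum>i=1..m. poincare_dist (a i) (b i))"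
      and 2: "kchain X y z n a' b' f'" "L2 = (\<Sum>i=1..n. poincare_dist (a' i) (b' i))"
    for m a b f L1 n a' b' f' L2
  proof -
    let ?s = "\<lambda>i. poincare_dist (if i \<le> m then a i else a' (i - m)) (if i \<le> m then b i else b' (i - m))"
    have "(\<Sum>i=1..m + n. ?s i) = (\<Sum>i=1..m. ?s i) + (\<Sum>i=m + 1..m + n. ?s i)"
      by (rule sum.ub_add_nat) simp
    also have "(\<Sum>i=m + 1..m + n. ?s i) = (\<Sum>i=1..n. ?s (i + m))"
      using sum.shift_bounds_cl_nat_ivl[of ?s 1 m n] by (simp add: add.commute)
    also have "(\<Sum>i=1..n. ?s (i + m)) = L2"
      unfolding 2(2) by (intro sum.cong) auto
    also have "(\<Sum>i=1..m. ?s i) = L1"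
      unfolding 1(2) by (intro sum.cong) auto
    finally show ?thesis
      using kobayashi_dist_le[OF kchain_append[OF 1(1) 2(1)]] by simp
  qed
  show ?thesis
  proof (rule ereal_le_epsilon2)
    fix e :: real assume e: "e > 0"
    show "kobayashi_dist X x z \<le> kobayashi_dist X x y + kobayashi_dist X y z + ereal e"
    proof (cases "kobayashi_dist X x y = \<infinity> \<or> kobayashi_dist X y z = \<infinity>")
      case True
      then show ?thesis
        using kobayashi_dist_nonneg[of X x y] kobayashi_dist_nonneg[of X y z] by auto
    next
      case False
      then obtain k1 k2 where k: "kobayashi_dist X x y = ereal k1" "kobayashi_dist X y z = ereal k2"
        using kobayashi_dist_nonneg[of X x y] kobayashi_dist_nonneg[of X y z]
        by (cases "kobayashi_dist X x y"; cases "kobayashi_dist X y z") auto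
      have "kobayashi_dist X x y < ereal (k1 + e / 2)" "kobayashi_dist X y z < ereal (k2 + e / 2)"
        using k e by simp_all
      note lt = this[unfolded kobayashi_dist_eq Inf_less_iff]
      obtain m a b f where 1: "kchain X x y m a b f" "(\<Sum>i=1..m. poincare_dist (a i) (b i)) < k1 + e / 2"
        using lt(1) by auto
      obtain n a' b' f' where 2: "kchain X y z n a' b' f'" "(\<Sum>i=1..n. poincare_dist (a' i) (b' i)) < k2 + e / 2"
        using lt(2) by auto
      have "kobayashi_dist X x z \<le> ereal ((\<Sum>i=1..m. poincare_dist (a i) (b i)) + (\<Sum>i=1..n. poincare_dist (a' i) (b' i)))"
        using *[OF 1(1) refl 2(1) refl] by simp
      also have "\<dots> \<le> ereal (k1 + k2 + e)"
        unfolding ereal_less_eq using 1(2) 2(2) by argo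
      finally show ?thesis
        using k by simp
    qed
  qed
qed

lemma kobayashi_dist_refl:
  assumes "z \<in> X"
  shows "kobayashi_dist X z z = 0"
proof -
  have "kobayashi_dist X z z \<le> ereal (poincare_dist 0 0)"
    by (rule kobayashi_dist_disc[of "\<lambda>_. z"]) (use assms in \<open>auto simp: holomorphic_curve_def\<close>)
  then show ?thesis
    using kobayashi_dist_nonneg[of X z z] by (simp add: poincare_dist_refl antisym flip: zero_ereal_def)
qed

lemma holomorphic_curve_line: "holomorphic_curve (\<lambda>t. p + t *s (v :: complex ^ 'n)) A"
  by (auto simp: holomorphic_curve_def intro!: holomorphic_intros)

lemma norm_vector_smult: "norm (c *s (x :: complex ^ 'n)) = cmod c * norm x"
  unfolding norm_vec_def by (simp add: norm_mult L2_set_right_distrib)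

text \<open>Being at finite distance is an equivalence relation, and small affine discs make its
  classes open; a connected set has only one class.\<close>

lemma kobayashi_dist_finite:
  assumes X: "open X" "connected X" and zw: "z \<in> X" "w \<in> X"
  shows "kobayashi_dist X z w < \<infinity>"
proof -
  have "\<exists>T. openin (top_of_set X) T \<and> x \<in> T \<and> (\<forall>y\<in>T. kobayashi_dist X x y < \<infinity>)" if x: "x \<in> X" for x
  proof -
    obtain e where e: "e > 0" "ball x e \<subseteq> X"
      using X(1) x open_contains_ball by blast
    have "kobayashi_dist X x y < \<infinity>" if y: "y \<in> ball x (e / 2)" for y
    proof -
      \<comment> \<open>The factor 2 places \<open>y\<close> at the interior parameter 1/2 of the
        disc.\<close>
      let ?g = "\<lambda>t. x + t *s (2 *s (y - x))"
      have "?g ` unit_disc \<subseteq> X"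
      proof clarify
        fix t :: complex assume t: "t \<in> unit_disc"
        have "norm (t *s (2 *s (y - x))) = cmod t * (2 * norm (y - x))"
          unfolding norm_vector_smult by simp
        also have "\<dots> \<le> 2 * norm (y - x)"
          using t by (intro mult_left_le_one_le) auto
        also have "\<dots> < e"
          using y by (simp add: dist_norm norm_minus_commute)
        finally have "dist (?g t) x < e"
          by (simp only: dist_norm add_diff_cancel_left')
        then show "?g t \<in> X"
          using e(2) by (auto simp: dist_commute)
      qed
      then have "kobayashi_dist X (?g 0) (?g (1 / 2)) \<le> ereal (poincare_dist 0 (1 / 2))"
        by (intro kobayashi_dist_disc holomorphic_curve_line) auto
      moreover have "?g 0 = x" "?g (1 / 2) = y"
        by (simp_all add: vec_eq_iff)
      ultimately have "kobayashi_dist X x y \<le> ereal (poincare_dist 0 (1 / 2))"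
        by simp
      then show ?thesis
        by (rule le_less_trans) simp
    qed
    then show ?thesis
      using e x by (intro exI[of _ "X \<inter> ball x (e / 2)"]) (auto intro: openin_open_Int)
  qed
  then show ?thesis
  proof (rule connected_equivalence_relation[OF X(2) zw, of "\<lambda>x y. kobayashi_dist X x y < \<infinity>", rotated 2])
    show "kobayashi_dist X x y < \<infinity>" if "kobayashi_dist X y x < \<infinity>" for x y
      using that kobayashi_dist_commute by metis
    show "kobayashi_dist X x z < \<infinity>" if "kobayashi_dist X x y < \<infinity>" "kobayashi_dist X y z < \<infinity>" for x y z
      using that kobayashi_dist_triangle[of X x z y] by (auto simp: less_le)
  qed
qed

section \<open>The Caratheodory pseudo-distance and its comparison with Kobayashi's\<close>

lemma caratheodory_dist_ge:
  assumes "holomorphic_fun g X" "g ` X \<subseteq> unit_disc"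
  shows "ereal (poincare_dist (g z) (g w)) \<le> caratheodory_dist X z w"
  unfolding caratheodory_dist_def by (rule Sup_upper) (use assms in blast)

text \<open>Following a chain by a competitor \<open>g\<close> gives holomorphic self-maps of the
  disc; Schwarz-Pick bounds each link and the triangle inequality adds them up. This yields
  finiteness of the Caratheodory distance and the passage from its balls to Kobayashi balls.\<close>

lemma caratheodory_le_kobayashi:
  assumes X: "open X"
  shows "caratheodory_dist X z w \<le> kobayashi_dist X z w"
  unfolding caratheodory_dist_def kobayashi_dist_eq
proof (rule Sup_least, rule Inf_greatest, clarify)
  fix g m a b f
  assume g: "holomorphic_fun g X" "g ` X \<subseteq> unit_disc" and c: "kchain X z w m a b f"
  have disc: "a i \<in> unit_disc" "b i \<in> unit_disc" "holomorphic_curve (f i) unit_disc" "f i ` unit_disc \<subseteq> X"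
    if "i \<in> {1..m}" for i
    using c that by (auto simp: kchain_def)
  have into: "g (f i t) \<in> unit_disc" if "i \<in> {1..m}" "t \<in> unit_disc" for i t
    using disc(4)[OF that(1)] that(2) g(2) by blast
  have contract: "poincare_dist (g (f i (a i))) (g (f i (b i))) \<le> poincare_dist (a i) (b i)" if i: "i \<in> {1..m}" for i
    by (rule Schwarz_Pick[of "\<lambda>t. g (f i t)"])
       (use disc[OF i] into[OF i] in \<open>auto intro!: holomorphic_fun_curve[OF g(1) X] simp del: mem_ball_0\<close>)
  have "poincare_dist (g z) (g (f n (b n))) \<le> (\<Sum>i=1..n. poincare_dist (a i) (b i))"
    if "1 \<le> n" "n \<le> m" for n
    using that
  proof (induction n rule: dec_induct)
    case base
    then show ?case
      using contract[of 1] c by (simp add: kchain_def)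
  next
    case (step n)
    have n: "n \<in> {1..m}" "Suc n \<in> {1..m}" "1 \<in> {1..m}"
      using step by auto
    have "f n (b n) = f (Suc n) (a (Suc n))"
      using c step by (simp add: kchain_def)
    then have "poincare_dist (g z) (g (f (Suc n) (b (Suc n)))) \<le>
        poincare_dist (g z) (g (f n (b n))) + poincare_dist (g (f (Suc n) (a (Suc n)))) (g (f (Suc n) (b (Suc n))))"
      using poincare_dist_triangle[of "g z" "g (f n (b n))" "g (f (Suc n) (b (Suc n)))"]
        into[OF n(1) disc(2)[OF n(1)]] into[OF n(2) disc(2)[OF n(2)]] into[OF n(3) disc(1)[OF n(3)]] c
      by (simp add: kchain_def)
    then show ?case
      using step.IH step.prems contract[OF n(2)] by simp
  qed
  from this[of m] c show "ereal (poincare_dist (g z) (g w)) \<le> ereal (\<Sum>i=1..m. poincare_dist (a i) (b i))"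
    by (simp add: kchain_def)
qed

text \<open>An empty supremum in \<open>ereal\<close> would be negative infinity; the constant 0 is
  always a competitor.\<close>

lemma caratheodory_dist_nonneg:
  assumes "z \<in> X" "w \<in> X"
  shows "0 \<le> caratheodory_dist X z w"
proof -
  have "holomorphic_fun (\<lambda>_. 0) X"
    unfolding holomorphic_fun_def by (auto intro!: exI[of _ "\<lambda>_. 0"])
  moreover have "(\<lambda>_. 0) ` X \<subseteq> unit_disc"
    by auto
  ultimately have "ereal (poincare_dist 0 0) \<le> caratheodory_dist X z w"
    by (rule caratheodory_dist_ge)
  then show ?thesis
    by (simp add: poincare_dist_refl zero_ereal_def)
qed

lemma caratheodory_dist_commute:
  assumes "z \<in> X" "w \<in> X"
  shows "caratheodory_dist X z w = caratheodory_dist X w z"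
proof -
  have "caratheodory_dist X z w \<le> caratheodory_dist X w z" if zw: "z \<in> X" "w \<in> X" for z w
    unfolding caratheodory_dist_def[of X z w]
  proof (rule Sup_least, clarify)
    fix g assume g: "holomorphic_fun g X" "g ` X \<subseteq> unit_disc"
    have "poincare_dist (g z) (g w) = poincare_dist (g w) (g z)"
      using g(2) zw by (intro poincare_dist_commute) auto
    then show "ereal (poincare_dist (g z) (g w)) \<le> caratheodory_dist X w z"
      using caratheodory_dist_ge[OF g] by simp
  qed
  then show ?thesis
    using assms by (simp add: antisym)
qed

lemma caratheodory_dist_triangle:
  assumes "x \<in> X" "y \<in> X" "z \<in> X"
  shows "caratheodory_dist X x z \<le> caratheodory_dist X x y + caratheodory_dist X y z"
  unfolding caratheodory_dist_def[of X x z]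
proof (rule Sup_least, clarify)
  fix g assume g: "holomorphic_fun g X" "g ` X \<subseteq> unit_disc"
  have "poincare_dist (g x) (g z) \<le> poincare_dist (g x) (g y) + poincare_dist (g y) (g z)"
    using g(2) assms by (intro poincare_dist_triangle) auto
  then have "ereal (poincare_dist (g x) (g z)) \<le> ereal (poincare_dist (g x) (g y)) + ereal (poincare_dist (g y) (g z))"
    by simp
  also have "\<dots> \<le> caratheodory_dist X x y + caratheodory_dist X y z"
    by (intro add_mono caratheodory_dist_ge g)
  finally show "ereal (poincare_dist (g x) (g z)) \<le> caratheodory_dist X x y + caratheodory_dist X y z" .
qed

lemma hyperbolicI:
  assumes fin: "\<And>z w. z \<in> X \<Longrightarrow> w \<in> X \<Longrightarrow> d X z w < \<infinity>"
    and nonneg: "\<And>z w. z \<in> X \<Longrightarrow> w \<in> X \<Longrightarrow> 0 \<le> d X z w"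
    and refl: "\<And>z. z \<in> X \<Longrightarrow> d X z z = 0"
    and pos: "\<And>z w. z \<in> X \<Longrightarrow> w \<in> X \<Longrightarrow> z \<noteq> w \<Longrightarrow> 0 < d X z w"
    and sym: "\<And>z w. z \<in> X \<Longrightarrow> w \<in> X \<Longrightarrow> d X z w = d X w z"
    and tri: "\<And>x y z. x \<in> X \<Longrightarrow> y \<in> X \<Longrightarrow> z \<in> X \<Longrightarrow> d X x z \<le> d X x y + d X y z"
  shows "hyperbolic d X"
proof -
  have real: "d X z w = ereal (real_of_ereal (d X z w))" if "z \<in> X" "w \<in> X" for z w
    using fin[OF that] nonneg[OF that] by (cases "d X z w") auto
  show ?thesis
    unfolding hyperbolic_def
  proof (intro conjI ballI)
    show "\<bar>d X z w\<bar> \<noteq> \<infinity>" if "z \<in> X" "w \<in> X" for z w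
      by (subst real[OF that]) simp
    show "Metric_space X (\<lambda>z w. if z \<in> X \<and> w \<in> X then real_of_ereal (d X z w) else 0)"
    proof
      show "0 \<le> (if x \<in> X \<and> y \<in> X then real_of_ereal (d X x y) else 0)" for x y
        using nonneg by (simp add: real_of_ereal_pos)
      show "(if x \<in> X \<and> y \<in> X then real_of_ereal (d X x y) else 0) =
          (if y \<in> X \<and> x \<in> X then real_of_ereal (d X y x) else 0)" for x y
        using sym by auto
      show "(if x \<in> X \<and> y \<in> X then real_of_ereal (d X x y) else 0) = 0 \<longleftrightarrow> x = y"
        if "x \<in> X" "y \<in> X" for x y
      proof (cases "x = y")
        case False
        then have "d X x y \<noteq> 0"
          using pos[OF that] by simp
        then show ?thesis
          using False that real[OF that] by (auto simp: zero_ereal_def)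
      qed (use that refl in simp)
      show "(if x \<in> X \<and> z \<in> X then real_of_ereal (d X x z) else 0) \<le>
          (if x \<in> X \<and> y \<in> X then real_of_ereal (d X x y) else 0) +
          (if y \<in> X \<and> z \<in> X then real_of_ereal (d X y z) else 0)"
        if xyz: "x \<in> X" "y \<in> X" "z \<in> X" for x y z
      proof -
        obtain p q r where "d X x z = ereal p" "d X x y = ereal q" "d X y z = ereal r"
          using real[OF xyz(1,3)] real[OF xyz(1,2)] real[OF xyz(2,3)] by blast
        then show ?thesis
          using tri[OF xyz] xyz by simp
      qed
    qed
  qed
qed

section \<open>Geometry of the unit ball\<close>

lemma holomorphic_fun_const: "holomorphic_fun (\<lambda>_. c) S"
  unfolding holomorphic_fun_def by (auto intro!: exI[of _ "\<lambda>_. 0"])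

lemma holomorphic_fun_add:
  assumes "holomorphic_fun f S" "holomorphic_fun g S"
  shows "holomorphic_fun (\<lambda>x. f x + g x) S"
  unfolding holomorphic_fun_def
proof
  fix x assume "x \<in> S"
  then obtain f' g' where
    "(f has_derivative f') (at x within S)" "\<And>c v. f' (c *s v) = c * f' v"
    "(g has_derivative g') (at x within S)" "\<And>c v. g' (c *s v) = c * g' v"
    using assms unfolding holomorphic_fun_def by metis
  then show "\<exists>f'. ((\<lambda>x. f x + g x) has_derivative f') (at x within S) \<and> (\<forall>c v. f' (c *s v) = c * f' v)"
    by (intro exI[of _ "\<lambda>v. f' v + g' v"]) (auto intro: has_derivative_add simp: distrib_left)
qed

lemma holomorphic_fun_mult:
  assumes "holomorphic_fun f S" "holomorphic_fun g S"
  shows "holomorphic_fun (\<lambda>x. f x * g x) S"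
  unfolding holomorphic_fun_def
proof
  fix x assume "x \<in> S"
  then obtain f' g' where
    "(f has_derivative f') (at x within S)" "\<And>c v. f' (c *s v) = c * f' v"
    "(g has_derivative g') (at x within S)" "\<And>c v. g' (c *s v) = c * g' v"
    using assms unfolding holomorphic_fun_def by metis
  then show "\<exists>f'. ((\<lambda>x. f x * g x) has_derivative f') (at x within S) \<and> (\<forall>c v. f' (c *s v) = c * f' v)"
    by (intro exI[of _ "\<lambda>v. f x * g' v + f' v * g x"])
       (auto intro: has_derivative_mult simp: algebra_simps)
qed

lemma holomorphic_fun_divide:
  assumes "holomorphic_fun f S" "holomorphic_fun g S" "\<And>x. x \<in> S \<Longrightarrow> g x \<noteq> 0"
  shows "holomorphic_fun (\<lambda>x. f x / g x) S"
  unfolding holomorphic_fun_def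
proof
  fix x assume x: "x \<in> S"
  then obtain f' g' where D:
    "(f has_derivative f') (at x within S)" "\<And>c v. f' (c *s v) = c * f' v"
    "(g has_derivative g') (at x within S)" "\<And>c v. g' (c *s v) = c * g' v"
    using assms(1,2) unfolding holomorphic_fun_def by metis
  have "((\<lambda>x. f x / g x) has_derivative (\<lambda>v. (f' v * g x - f x * g' v) / (g x * g x))) (at x within S)"
    by (rule has_derivative_divide'[OF D(1,3) assms(3)[OF x]])
  then show "\<exists>f'. ((\<lambda>x. f x / g x) has_derivative f') (at x within S) \<and> (\<forall>c v. f' (c *s v) = c * f' v)"
    by (intro exI conjI, assumption) (auto simp: D(2,4) algebra_simps)
qed

lemma holomorphic_fun_sum:
  "(\<And>i. i \<in> I \<Longrightarrow> holomorphic_fun (f i) S) \<Longrightarrow> holomorphic_fun (\<lambda>x. \<Sum>i\<in>I. f i x) S"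
  by (induction I rule: infinite_finite_induct) (auto intro: holomorphic_fun_const holomorphic_fun_add)

lemma holomorphic_fun_nth: "holomorphic_fun (\<lambda>x. x $ i) S"
  unfolding holomorphic_fun_def
  by (auto intro!: exI[of _ "\<lambda>x. x $ i"] bounded_linear_imp_has_derivative bounded_linear_vec_nth)

lemma holomorphic_fun_compose:
  assumes g: "holomorphic_fun g T" "open T" and f: "holomorphic_map f S" "open S" "f ` S \<subseteq> T"
  shows "holomorphic_fun (\<lambda>x. g (f x)) S"
  unfolding holomorphic_fun_def
proof
  fix x assume x: "x \<in> S"
  obtain g' where g': "(g has_derivative g') (at (f x))" "\<And>c v. g' (c *s v) = c * g' v"
    using holomorphic_fun_at[OF g, of "f x"] f(3) x by blast
  have "((\<lambda>x. g (f x)) has_derivative (\<lambda>v. g' (cjacobian f x *v v))) (at x within S)"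
    by (rule has_derivative_at_withinI,
        rule has_derivative_compose[OF holomorphic_map_has_derivative[OF f(1,2) x] g'(1)])
  then show "\<exists>f'. ((\<lambda>x. g (f x)) has_derivative f') (at x within S) \<and> (\<forall>c v. f' (c *s v) = c * f' v)"
    by (intro exI conjI, assumption) (simp add: vector_scalar_commute g'(2))
qed

section \<open>Hermitian product, dilations along an axis and ball automorphisms\<close>

definition herm :: "complex ^ 'n \<Rightarrow> complex ^ 'n \<Rightarrow> complex" where
  "herm x y = (\<Sum>i\<in>UNIV. x $ i * cnj (y $ i))"

lemma herm_add: "herm (x + y) p = herm x p + herm y p"
  and herm_diff: "herm (x - y) p = herm x p - herm y p"
  and herm_smult: "herm (c *s x) p = c * herm x p"
  and herm_zero [simp]: "herm 0 p = 0" "herm p 0 = 0"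
  by (simp_all add: herm_def algebra_simps sum.distrib sum_subtractf sum_distrib_left)

lemma herm_smult_right: "herm x (c *s y) = cnj c * herm x y"
  by (simp add: herm_def sum_distrib_left mult_ac)

lemma Re_herm: "Re (herm x y) = inner x y"
  by (simp add: herm_def inner_vec_def inner_complex_def)

lemma herm_cnj: "herm y x = cnj (herm x y)"
  by (simp add: herm_def mult.commute)

lemma herm_self: "herm x x = of_real ((norm x)\<^sup>2)"
proof -
  have "Im (herm x x) = 0"
    by (simp add: herm_def)
  then show ?thesis
    by (simp add: complex_eq_iff Re_herm power2_norm_eq_inner)
qed

lemma norm_add_sq: "(norm (x + y :: complex ^ 'n))\<^sup>2 = (norm x)\<^sup>2 + 2 * Re (herm x y) + (norm y)\<^sup>2"
  by (simp add: power2_norm_eq_inner Re_herm inner_add inner_commute)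

text \<open>A unimodular factor rotates the product to a nonnegative real number, which reduces the
  claim to the real inequality for \<open>inner\<close>.\<close>

lemma herm_Cauchy_Schwarz: "cmod (herm x y) \<le> norm x * norm y"
proof (cases "herm x y = 0")
  case False
  define c where "c = cnj (herm x y) / cmod (herm x y)"
  have "cmod c = 1"
    using False by (simp add: c_def norm_divide)
  have "c * herm x y = of_real (cmod (herm x y))"
    using False complex_norm_square[of "herm x y"]
    by (simp add: c_def field_simps power2_eq_square)
  then have "cmod (herm x y) = inner (c *s x) y"
    by (simp flip: Re_herm add: herm_smult)
  also have "\<dots> \<le> norm (c *s x) * norm y"
    by (rule norm_cauchy_schwarz)
  finally show ?thesis
    by (simp add: norm_vector_smult \<open>cmod c = 1\<close>)
qed simp

text \<open>This vanishes for \<open>p = 0\<close>, where the quotient is \<open>0 / 0\<close>.\<close>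

definition along :: "complex ^ 'n \<Rightarrow> complex ^ 'n \<Rightarrow> complex ^ 'n" where
  "along p x = (herm x p / herm p p) *s p"

text \<open>Dilation by \<open>\<alpha>\<close> on the complex line of \<open>p\<close> and by
  \<open>\<beta>\<close> on its orthogonal complement; for \<open>p = 0\<close> it is multiplication
  by \<open>\<beta>\<close>.\<close>

definition ax_scale :: "real \<Rightarrow> real \<Rightarrow> complex ^ 'n \<Rightarrow> complex ^ 'n \<Rightarrow> complex ^ 'n" where
  "ax_scale \<alpha> \<beta> p x = of_real \<alpha> *s along p x + of_real \<beta> *s (x - along p x)"

lemma herm_along [simp]: "herm (along p x) p = herm x p"
  by (cases "p = 0") (simp_all add: along_def herm_smult herm_self)

lemma along_linear:
  "along p (x + y) = along p x + along p y" "along p (c *s x) = c *s along p x"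
  "along p (x - y) = along p x - along p y"
  by (simp_all add: along_def herm_add herm_diff herm_smult add_divide_distrib diff_divide_distrib
      vec_eq_iff algebra_simps)

lemma along_self [simp]: "along p p = p"
  by (cases "p = 0") (simp_all add: along_def herm_self)

lemma along_along [simp]: "along p (along p x) = along p x"
  by (simp add: along_def[of p x] along_linear(2))

lemma herm_ax_scale: "herm (ax_scale \<alpha> \<beta> p x) p = of_real \<alpha> * herm x p"
  by (simp add: ax_scale_def herm_add herm_diff herm_smult)

lemma along_ax_scale: "along p (ax_scale \<alpha> \<beta> p x) = of_real \<alpha> *s along p x"
  by (simp add: ax_scale_def along_linear)

text \<open>In particular \<open>ax_scale (\<delta>\<^sup>2) \<delta> p\<close> inverts
  \<open>ax_scale 1 \<delta> p\<close> up to the factor \<open>\<delta>\<^sup>2\<close>.\<close>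

lemma ax_scale_scale: "ax_scale \<alpha> \<beta> p (ax_scale \<alpha>' \<beta>' p x) = ax_scale (\<alpha> * \<alpha>') (\<beta> * \<beta>') p x"
  unfolding ax_scale_def[of \<alpha> \<beta>] along_ax_scale
  by (simp add: ax_scale_def vec_eq_iff algebra_simps)

lemma ax_scale_const [simp]: "ax_scale \<alpha> \<alpha> p x = of_real \<alpha> *s x"
  by (simp add: ax_scale_def vec_eq_iff algebra_simps)

lemma ax_scale_self [simp]: "ax_scale \<alpha> \<beta> p p = of_real \<alpha> *s p"
  by (simp add: ax_scale_def)

lemma ax_scale_linear:
  "ax_scale \<alpha> \<beta> p (x + y) = ax_scale \<alpha> \<beta> p x + ax_scale \<alpha> \<beta> p y"
  "ax_scale \<alpha> \<beta> p (x - y) = ax_scale \<alpha> \<beta> p x - ax_scale \<alpha> \<beta> p y"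
  "ax_scale \<alpha> \<beta> p (c *s x) = c *s ax_scale \<alpha> \<beta> p x"
  by (simp_all add: ax_scale_def along_linear vec_eq_iff algebra_simps)

lemma norm_along_sq: "(cmod (herm x p))\<^sup>2 = (norm p)\<^sup>2 * (norm (along p x))\<^sup>2"
proof (cases "p = 0")
  case False
  then have "norm (along p x) = cmod (herm x p) / norm p"
    by (simp add: along_def norm_vector_smult herm_self norm_divide norm_mult power2_eq_square[of "norm p"])
  then show ?thesis
    using False by (simp add: power_divide)
qed (simp add: along_def)

text \<open>Pythagoras: the added multiple of \<open>p\<close> interacts with the component along
  \<open>p\<close> only, and the last difference is the squared norm of the orthogonal
  component.\<close>

lemma norm_ax_scale_sq:
  "(norm (ax_scale \<alpha> \<beta> p x + of_real \<gamma> *s p))\<^sup>2 =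
    \<alpha>\<^sup>2 * (norm (along p x))\<^sup>2 + 2 * \<alpha> * \<gamma> * Re (herm x p) + \<gamma>\<^sup>2 * (norm p)\<^sup>2
      + \<beta>\<^sup>2 * ((norm x)\<^sup>2 - (norm (along p x))\<^sup>2)"
proof -
  let ?P = "along p x"
  let ?Q = "x - ?P"
  have Qp: "herm p ?Q = 0"
    using herm_cnj[of p ?Q] by (simp add: herm_diff)
  have QP: "herm ?P ?Q = 0"
    by (simp add: along_def[of p x] herm_smult Qp[unfolded along_def])
  have "(norm x)\<^sup>2 = (norm ?P)\<^sup>2 + (norm ?Q)\<^sup>2"
    using norm_add_sq[of ?P ?Q] QP by simp
  have "herm (of_real \<alpha> *s ?P + of_real \<gamma> *s p) (of_real \<beta> *s ?Q) = 0"
    by (simp only: herm_add herm_smult herm_smult_right QP Qp) simp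
  then have "(norm ((of_real \<alpha> *s ?P + of_real \<gamma> *s p) + of_real \<beta> *s ?Q))\<^sup>2
      = (norm (of_real \<alpha> *s ?P + of_real \<gamma> *s p))\<^sup>2 + (norm (of_real \<beta> *s ?Q))\<^sup>2"
    by (simp add: norm_add_sq[of "of_real \<alpha> *s ?P + of_real \<gamma> *s p"])
  also have "(norm (of_real \<alpha> *s ?P + of_real \<gamma> *s p))\<^sup>2
      = \<alpha>\<^sup>2 * (norm ?P)\<^sup>2 + 2 * \<alpha> * \<gamma> * Re (herm x p) + \<gamma>\<^sup>2 * (norm p)\<^sup>2"
    by (simp add: norm_add_sq herm_smult herm_smult_right norm_vector_smult power_mult_distrib)
  also have "(norm (of_real \<beta> *s ?Q))\<^sup>2 = \<beta>\<^sup>2 * (norm ?Q)\<^sup>2"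
    unfolding norm_vector_smult power_mult_distrib by simp
  finally show ?thesis
    using \<open>(norm x)\<^sup>2 = _\<close> by (simp add: ax_scale_def add_ac)
qed

text \<open>For \<open>\<delta>\<^sup>2 = 1 - \<parallel>p\<parallel>\<^sup>2\<close>, the automorphism of the unit ball sending \<open>p\<close> to \<open>0\<close>.\<close>

definition ball_aut :: "complex ^ 'n \<Rightarrow> real \<Rightarrow> complex ^ 'n \<Rightarrow> complex ^ 'n" where
  "ball_aut p \<delta> x = (1 / (1 - herm x p)) *s (ax_scale 1 \<delta> p x - p)"

context
  fixes p :: "complex ^ 'n" and \<delta> :: real
  assumes p: "norm p < 1" and \<delta>: "\<delta> > 0" "\<delta>\<^sup>2 = 1 - (norm p)\<^sup>2"
begin

lemma delta_le_1: "\<delta> \<le> 1"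
proof -
  have "\<delta>\<^sup>2 \<le> 1\<^sup>2"
    using \<delta>(2) by simp
  then show ?thesis
    by (rule power2_le_imp_le) simp
qed

text \<open>The ellipsoid centred at \<open>p\<close> whose axes have size \<open>\<delta>\<^sup>2\<close> along \<open>p\<close> and \<open>\<delta>\<close> orthogonally
  to it has the shape of an invariant ball centred at \<open>p\<close>.\<close>

lemma ellipsoid_in_ball:
  assumes w: "norm w \<le> 1"
  shows "norm (p + (1 / 3) *s ax_scale (\<delta>\<^sup>2) \<delta> p w) < 1"
proof -
  have "p + (1 / 3) *s ax_scale (\<delta>\<^sup>2) \<delta> p w = ax_scale (\<delta>\<^sup>2 / 3) (\<delta> / 3) p w + of_real 1 *s p"
    by (simp add: ax_scale_def vec_eq_iff algebra_simps)
  then have "(norm (p + (1 / 3) *s ax_scale (\<delta>\<^sup>2) \<delta> p w))\<^sup>2 =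
      (\<delta>\<^sup>2 / 3)\<^sup>2 * (norm (along p w))\<^sup>2 + 2 * (\<delta>\<^sup>2 / 3) * Re (herm w p) + (norm p)\<^sup>2
      + (\<delta> / 3)\<^sup>2 * ((norm w)\<^sup>2 - (norm (along p w))\<^sup>2)"
    by (simp only: norm_ax_scale_sq) simp
  \<comment> \<open>Since \<open>\<delta> \<le> 1\<close>, the shorter axis may be enlarged in the
    quadratic term, where the two components then combine to the norm of \<open>w\<close>; the cross
    term needs the true size \<open>\<delta>\<^sup>2\<close>.\<close>
  also have "\<dots> \<le> (\<delta> / 3)\<^sup>2 * (norm (along p w))\<^sup>2 + 2 * (\<delta>\<^sup>2 / 3) * 1 + (norm p)\<^sup>2
      + (\<delta> / 3)\<^sup>2 * ((norm w)\<^sup>2 - (norm (along p w))\<^sup>2)"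
  proof -
    have "Re (herm w p) \<le> 1"
      using complex_Re_le_cmod[of "herm w p"] herm_Cauchy_Schwarz[of w p]
        mult_le_one[OF w norm_ge_zero, of p] p by linarith
    moreover have "\<delta>\<^sup>2 / 3 \<le> \<delta> / 3"
      using \<delta>(1) delta_le_1 by (simp add: power2_eq_square mult_left_le)
    then have "(\<delta>\<^sup>2 / 3)\<^sup>2 \<le> (\<delta> / 3)\<^sup>2"
      by (rule power_mono) simp
    then have "(\<delta>\<^sup>2 / 3)\<^sup>2 * (norm (along p w))\<^sup>2 \<le> (\<delta> / 3)\<^sup>2 * (norm (along p w))\<^sup>2"
      by (rule mult_right_mono) simp
    moreover have "2 * (\<delta>\<^sup>2 / 3) * Re (herm w p) \<le> 2 * (\<delta>\<^sup>2 / 3) * 1"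
      using \<open>Re (herm w p) \<le> 1\<close> by (rule mult_left_mono) simp
    ultimately show ?thesis
      by linarith
  qed
  also have "\<dots> = (\<delta> / 3)\<^sup>2 * (norm w)\<^sup>2 + 2 * (\<delta>\<^sup>2 / 3) + (norm p)\<^sup>2"
    by (simp add: algebra_simps)
  also have "\<dots> \<le> (\<delta> / 3)\<^sup>2 + 2 * (\<delta>\<^sup>2 / 3) + (norm p)\<^sup>2"
    using w by (simp add: power_le_one mult_left_le)
  \<comment> \<open>The factor 1/3 pays off here: 1/9 + 2/3 is less than the 1 gained from the norm
    of \<open>p\<close>.\<close>
  also have "\<dots> = 1 - 2 / 9 * \<delta>\<^sup>2"
  proof -
    have "(norm p)\<^sup>2 = 1 - \<delta>\<^sup>2"
      using \<delta>(2) by simp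
    then show ?thesis
      by (simp add: power_divide field_simps)
  qed
  also have "\<dots> < 1"
    using \<delta>(1) by simp
  finally show ?thesis
    by (simp add: power_less_one_iff)
qed

lemma one_minus_herm_nonzero:
  assumes "norm x < 1"
  shows "1 - herm x p \<noteq> 0"
proof -
  have "norm x * norm p < 1"
    using assms p by (metis mult_less_cancel_right1 mult_strict_mono' norm_ge_zero mult_1)
  then have "cmod (herm x p) < 1"
    using herm_Cauchy_Schwarz[of x p] by linarith
  then show ?thesis
    by auto
qed

text \<open>With N the vector in the numerator of the automorphism, |1 - <x,p>|^2 - |N|^2 = (1 -
  |p|^2) (1 - |x|^2), which is positive.\<close>

lemma norm_ball_aut:
  assumes x: "norm x < 1"
  shows "norm (ball_aut p \<delta> x) < 1"
proof -
  have "ax_scale 1 \<delta> p x - p = ax_scale 1 \<delta> p x + of_real (-1) *s p"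
    by (simp add: vec_eq_iff)
  then have 1: "(norm (ax_scale 1 \<delta> p x - p))\<^sup>2 = (norm (along p x))\<^sup>2 - 2 * Re (herm x p) + (norm p)\<^sup>2
      + \<delta>\<^sup>2 * ((norm x)\<^sup>2 - (norm (along p x))\<^sup>2)"
    by (simp only: norm_ax_scale_sq) simp
  have "(cmod (1 - herm x p))\<^sup>2 = 1 - 2 * Re (herm x p) + (cmod (herm x p))\<^sup>2"
    unfolding cmod_power2 by (simp add: power2_eq_square algebra_simps)
  then have 2: "(cmod (1 - herm x p))\<^sup>2 = 1 - 2 * Re (herm x p) + (norm p)\<^sup>2 * (norm (along p x))\<^sup>2"
    by (simp add: norm_along_sq)
  have "(cmod (1 - herm x p))\<^sup>2 - (norm (ax_scale 1 \<delta> p x - p))\<^sup>2 = \<delta>\<^sup>2 * (1 - (norm x)\<^sup>2)"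
    unfolding 1 2 \<delta>(2) by (simp add: algebra_simps)
  moreover have "\<delta>\<^sup>2 * (1 - (norm x)\<^sup>2) > 0"
    using \<delta>(1) x by (simp add: power_less_one_iff)
  ultimately have "(norm (ax_scale 1 \<delta> p x - p))\<^sup>2 < (cmod (1 - herm x p))\<^sup>2"
    by linarith
  then have "norm (ax_scale 1 \<delta> p x - p) < cmod (1 - herm x p)"
    by (rule power2_less_imp_less) simp
  then show ?thesis
    using one_minus_herm_nonzero[OF x] unfolding ball_aut_def norm_vector_smult
    by (simp add: norm_divide)
qed

text \<open>Solving for \<open>x\<close> shows where the ellipsoid comes from: up to the scalar 1 /
  (1 + <y,p>), the inverse is y -> p +
  \<open>ax_scale (\<delta>\<^sup>2) \<delta> p y\<close>.\<close>

lemma ball_aut_inverse: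
  assumes x: "norm x < 1"
  shows "x = p + (1 / (1 + herm (ball_aut p \<delta> x) p)) *s ax_scale (\<delta>\<^sup>2) \<delta> p (ball_aut p \<delta> x)"
    and "1 + herm (ball_aut p \<delta> x) p \<noteq> 0"
proof -
  let ?h = "1 - herm x p"
  have h: "?h \<noteq> 0"
    by (rule one_minus_herm_nonzero[OF x])
  have "herm (ball_aut p \<delta> x) p = (herm x p - of_real ((norm p)\<^sup>2)) / ?h"
    by (simp add: ball_aut_def herm_smult herm_diff herm_ax_scale herm_self diff_divide_distrib)
  then have "1 + herm (ball_aut p \<delta> x) p = (1 - of_real ((norm p)\<^sup>2)) / ?h"
    using h by (simp add: field_simps)
  then have 1: "1 + herm (ball_aut p \<delta> x) p = of_real (\<delta>\<^sup>2) / ?h"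
    using \<delta>(2) by simp
  then show "1 + herm (ball_aut p \<delta> x) p \<noteq> 0"
    using h \<delta>(1) by simp
  have "ax_scale (\<delta>\<^sup>2) \<delta> p (ball_aut p \<delta> x) = (1 / ?h) *s (of_real (\<delta>\<^sup>2) *s (x - p))"
    by (simp add: ball_aut_def ax_scale_linear ax_scale_scale power2_eq_square vec_eq_iff algebra_simps)
  then show "x = p + (1 / (1 + herm (ball_aut p \<delta> x) p)) *s ax_scale (\<delta>\<^sup>2) \<delta> p (ball_aut p \<delta> x)"
    unfolding 1 using h \<delta>(1) by (simp add: vec_eq_iff field_simps)
qed

text \<open>For an image of norm below s/6, the scalar 1 + <y,p> has modulus at least 5/6. Absorbing
  it and the factor s/3 into the point leaves a norm of at most (3 s/6) / (5 s/6) = 3/5.\<close>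

lemma in_ellipsoid:
  assumes x: "norm x < 1" and s: "0 < s" "s \<le> 1" and small: "norm (ball_aut p \<delta> x) < s / 6"
  obtains y where "norm y < 1" "x = p + of_real (s / 3) *s ax_scale (\<delta>\<^sup>2) \<delta> p y"
proof
  let ?k = "1 + herm (ball_aut p \<delta> x) p"
  define y where "y = (3 / (of_real s * ?k)) *s ball_aut p \<delta> x"
  have "cmod (herm (ball_aut p \<delta> x) p) \<le> norm (ball_aut p \<delta> x) * 1"
    using herm_Cauchy_Schwarz[of "ball_aut p \<delta> x" p] p
    by (meson less_imp_le mult_left_mono norm_ge_zero order_trans)
  then have k: "cmod ?k \<ge> 5 / 6"
    using norm_triangle_ineq2[of 1 "- herm (ball_aut p \<delta> x) p"] small s by simp
  have "norm y = 3 * norm (ball_aut p \<delta> x) / (s * cmod ?k)"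
    using s by (simp add: y_def norm_vector_smult norm_divide norm_mult)
  also have "\<dots> \<le> 3 * (s / 6) / (s * (5 / 6))"
    using small s k by (intro frac_le mult_left_mono) auto
  also have "\<dots> < 1"
    using s by simp
  finally show "norm y < 1" .
  have "x = p + (1 / ?k) *s ax_scale (\<delta>\<^sup>2) \<delta> p (ball_aut p \<delta> x)"
    by (rule ball_aut_inverse(1)[OF x])
  also have "\<dots> = p + of_real (s / 3) *s ax_scale (\<delta>\<^sup>2) \<delta> p y"
    using s by (simp add: y_def ax_scale_linear vec_eq_iff)
  finally show "x = p + of_real (s / 3) *s ax_scale (\<delta>\<^sup>2) \<delta> p y" .
qed

end

section \<open>Uniform thickness\<close>

text \<open>Turns a lower bound on the squeezing function into a lower bound on the radius.\<close>

lemma tanh_le_self: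
  assumes "0 \<le> (x :: real)"
  shows "tanh x \<le> x"
proof -
  have "tanh x - x \<le> tanh 0 - 0"
  proof (rule DERIV_nonpos_imp_nonincreasing[OF assms])
    fix y :: real
    show "\<exists>D. ((\<lambda>x. tanh x - x) has_real_derivative D) (at y) \<and> D \<le> 0"
      by (rule exI[of _ "(1 - tanh y ^ 2) - 1"]) (auto intro!: derivative_eq_intros)
  qed
  then show ?thesis
    by simp
qed

text \<open>The components of \<open>f\<close> are competitors for the Caratheodory distance and
  together separate points; its comparison with the Kobayashi distance carries positivity upwards
  and finiteness downwards.\<close>

lemma hyperbolic_of_injective:
  fixes X :: "(complex ^ 'n) set"
  assumes X: "open X" "connected X"
    and f: "holomorphic_map f X" "inj_on f X" "f ` X \<subseteq> (unit_ball :: (complex ^ 'n) set)"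
  shows "hyperbolic caratheodory_dist X" "hyperbolic kobayashi_dist X"
proof -
  have k: "kobayashi_dist X z w < \<infinity>" if "z \<in> X" "w \<in> X" for z w
    by (rule kobayashi_dist_finite[OF X that])
  have c_pos: "0 < caratheodory_dist X z w" if zw: "z \<in> X" "w \<in> X" "z \<noteq> w" for z w
  proof -
    obtain i where i: "f z $ i \<noteq> f w $ i"
      using f(2) zw by (metis inj_onD vec_eq_iff)
    have disc: "f x $ i \<in> unit_disc" if "x \<in> X" for x
      using f(3) that Finite_Cartesian_Product.norm_nth_le[of "f x" i]
      by (auto simp: image_subset_iff intro: le_less_trans)
    have "0 < 2 * cmod (f w $ i - f z $ i)"
      using i by simp
    also have "\<dots> \<le> poincare_dist (f z $ i) (f w $ i)"
      by (rule poincare_dist_lower) (use disc zw in auto)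
    finally have "0 < ereal (poincare_dist (f z $ i) (f w $ i))"
      by simp
    also have "\<dots> \<le> caratheodory_dist X z w"
      using disc f(1) by (intro caratheodory_dist_ge) (auto simp: holomorphic_map_def image_subset_iff)
    finally show ?thesis .
  qed
  note le = caratheodory_le_kobayashi[OF X(1)]
  show "hyperbolic caratheodory_dist X"
  proof (rule hyperbolicI)
    show "caratheodory_dist X z w < \<infinity>" if "z \<in> X" "w \<in> X" for z w
      using le k[OF that] by (rule le_less_trans)
    show "caratheodory_dist X z z = 0" if "z \<in> X" for z
      using le[of z z] caratheodory_dist_nonneg[OF that that] kobayashi_dist_refl[OF that] by simp
  qed (fact c_pos caratheodory_dist_nonneg caratheodory_dist_commute caratheodory_dist_triangle)+
  show "hyperbolic kobayashi_dist X"
  proof (rule hyperbolicI)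
    show "0 < kobayashi_dist X z w" if "z \<in> X" "w \<in> X" "z \<noteq> w" for z w
      using c_pos[OF that] le by (rule less_le_trans)
    show "kobayashi_dist X z w = kobayashi_dist X w z" for z w
      by (rule kobayashi_dist_commute)
    show "kobayashi_dist X x z \<le> kobayashi_dist X x y + kobayashi_dist X y z" for x y z
      by (rule kobayashi_dist_triangle)
  qed (simp_all add: k kobayashi_dist_nonneg kobayashi_dist_refl del: ereal_infty_less)
qed

lemma holomorphic_fun_ax_scale:
  assumes "holomorphic_map f S"
  shows "holomorphic_fun (\<lambda>x. ax_scale \<alpha> \<beta> p (f x) $ i) S"
    and "holomorphic_fun (\<lambda>x. herm (f x) p) S"
proof -
  have f: "holomorphic_fun (\<lambda>x. f x $ j) S" for j
    using assms by (simp add: holomorphic_map_def)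
  then show h: "holomorphic_fun (\<lambda>x. herm (f x) p) S"
    unfolding herm_def by (intro holomorphic_fun_sum holomorphic_fun_mult holomorphic_fun_const)
  \<comment> \<open>Written out, each component is a constant-coefficient combination of a component
    of \<open>f\<close> and of the product with \<open>p\<close>. With division by zero giving 0,
    this also holds for \<open>p = 0\<close>.\<close>
  have "ax_scale \<alpha> \<beta> p (f x) $ i
      = of_real \<beta> * f x $ i + (of_real (\<alpha> - \<beta>) / herm p p * p $ i) * herm (f x) p" for x
    by (simp add: ax_scale_def along_def algebra_simps diff_divide_distrib)
  then show "holomorphic_fun (\<lambda>x. ax_scale \<alpha> \<beta> p (f x) $ i) S"
    by (simp only:) (intro holomorphic_fun_add holomorphic_fun_mult holomorphic_fun_const f h)
qed

text \<open>The radius depends on \<open>s\<close> and the dimension, but not on \<open>z\<close> or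
  \<open>f\<close>. It is chosen so that halving it by the Poincare lower bound and adding
  \<open>CARD('n')\<close> components gives the s/6 required by \<open>in_ellipsoid\<close>.\<close>

lemma ball_embedding:
  fixes X :: "(complex ^ 'n) set"
  assumes X: "open X" "z \<in> X"
    and f: "holomorphic_map f X" "inj_on f X" "f ` X \<subseteq> (unit_ball :: (complex ^ 'n) set)"
    and r: "dist_ball kobayashi_dist unit_ball (f z) r \<subseteq> f ` X"
    and s: "0 < s" "s < 1" "poincare_dist 0 (of_real s) < r"
  obtains h :: "complex ^ 'n \<Rightarrow> complex ^ 'n" where
    "holomorphic_map h unit_ball" "inj_on h unit_ball" "h ` unit_ball \<subseteq> X"
    "dist_ball caratheodory_dist X z (s / (3 * CARD('n))) \<subseteq> h ` unit_ball"
proof -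
  define p where "p = f z"
  have fB: "norm (f x) < 1" if "x \<in> X" for x
    using f(3) that by (auto simp: image_subset_iff)
  have p: "norm p < 1"
    using fB X(2) by (simp add: p_def)
  define \<delta> where "\<delta> = sqrt (1 - (norm p)\<^sup>2)"
  have "(norm p)\<^sup>2 < 1"
    using p by (simp add: power_less_one_iff)
  then have \<delta>: "\<delta> > 0" "\<delta>\<^sup>2 = 1 - (norm p)\<^sup>2"
    by (simp_all add: \<delta>_def)
  let ?A = "ax_scale (\<delta>\<^sup>2) \<delta> p"
  define E where "E y = p + of_real (s / 3) *s ?A y" for y
  have E_image: "E y \<in> f ` X" if y: "y \<in> unit_ball" for y
  proof -
    \<comment> \<open>The affine disc through \<open>p\<close> reaches the boundary of the large
      ellipsoid of factor 1/3 at most; \<open>E y\<close> sits on it at parameter \<open>s\<close>,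
      hence within Kobayashi distance \<open>poincare_dist 0 s\<close> of \<open>p\<close>.\<close>
    let ?g = "\<lambda>t. p + t *s ((1 / 3) *s ?A y)"
    have "?g t \<in> unit_ball" if t: "t \<in> unit_disc" for t
    proof -
      have "norm (t *s y) \<le> 1"
        using t y by (simp add: norm_vector_smult mult_le_one)
      from ellipsoid_in_ball[OF p \<delta> this] show ?thesis
        by (simp add: ax_scale_linear mult.commute)
    qed
    then have g: "?g ` unit_disc \<subseteq> unit_ball"
      by blast
    have "?g 0 = p" "?g (of_real s) = E y"
      by (simp_all add: E_def vec_eq_iff)
    moreover have "kobayashi_dist unit_ball (?g 0) (?g (of_real s)) \<le> ereal (poincare_dist 0 (of_real s))"
      by (rule kobayashi_dist_disc[OF holomorphic_curve_line g]) (use s in auto)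
    ultimately have "kobayashi_dist unit_ball p (E y) \<le> ereal (poincare_dist 0 (of_real s))"
      by simp
    then have "kobayashi_dist unit_ball p (E y) < ereal r"
      by (rule le_less_trans) (use s in simp)
    moreover have "?g (of_real s) \<in> unit_ball"
      using g s by (intro subsetD[OF g] imageI) simp
    ultimately show ?thesis
      using r \<open>?g (of_real s) = E y\<close> by (auto simp: dist_ball_def p_def)
  qed
  have E_inj: "y = y'" if "E y = E y'" for y y'
  proof -
    have "?A y = ?A y'"
      using that s by (simp add: E_def)
    then have "ax_scale 1 \<delta> p (?A y) = ax_scale 1 \<delta> p (?A y')"
      by simp
    then have "of_real (\<delta>\<^sup>2) *s y = of_real (\<delta>\<^sup>2) *s y'"
      by (simp add: ax_scale_scale power2_eq_square flip: of_real_mult)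
    then show ?thesis
      using \<delta>(1) by simp
  qed
  have E_hol: "holomorphic_map E unit_ball"
  proof -
    have "holomorphic_map (\<lambda>y :: complex ^ 'n. y) unit_ball"
      by (simp add: holomorphic_map_def holomorphic_fun_nth)
    from holomorphic_fun_ax_scale(1)[OF this] show ?thesis
      unfolding holomorphic_map_def E_def vector_add_component vector_smult_component
      by (intro allI holomorphic_fun_add holomorphic_fun_mult holomorphic_fun_const)
  qed
  define h where "h y = inv_into X f (E y)" for y
  have fh: "f (h y) = E y" "h y \<in> X" if "y \<in> unit_ball" for y
    using E_image[OF that] by (auto simp: h_def f_inv_into_f inv_into_into)
  show ?thesis
  proof (rule that[of h])
    show "holomorphic_map h unit_ball"
      using holomorphic_inverse[OF f(1) X(1) f(2)] E_hol E_image
      unfolding h_def holomorphic_map_def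
      by (intro allI holomorphic_fun_compose[where f = E]) (auto simp: holomorphic_map_def)
    show "inj_on h unit_ball"
      by (rule inj_onI) (metis fh(1) E_inj)
    show "h ` unit_ball \<subseteq> X"
      using fh by blast
    show "dist_ball caratheodory_dist X z (s / (3 * CARD('n))) \<subseteq> h ` unit_ball"
    proof
      fix w assume "w \<in> dist_ball caratheodory_dist X z (s / (3 * CARD('n)))"
      then have w: "w \<in> X" "caratheodory_dist X z w < ereal (s / (3 * CARD('n)))"
        by (auto simp: dist_ball_def)
      let ?g = "\<lambda>i x. ball_aut p \<delta> (f x) $ i"
      have comp: "cmod (?g i w) < s / 6 / CARD('n)" for i
      proof -
        have "holomorphic_fun (?g i) X"
        proof -
          have "?g i = (\<lambda>x. (ax_scale 1 \<delta> p (f x) $ i + - p $ i) / (1 + - 1 * herm (f x) p))"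
            by (simp add: ball_aut_def fun_eq_iff diff_divide_distrib)
          moreover have "1 + - 1 * herm (f x) p \<noteq> 0" if "x \<in> X" for x
            using one_minus_herm_nonzero[OF p \<delta> fB[OF that]] by simp
          ultimately show ?thesis
            by (simp only:) (intro holomorphic_fun_divide holomorphic_fun_add holomorphic_fun_mult
                holomorphic_fun_const holomorphic_fun_ax_scale f)
        qed
        moreover have disc: "?g i x \<in> unit_disc" if "x \<in> X" for x
          using norm_ball_aut[OF p \<delta> fB[OF that]] Finite_Cartesian_Product.norm_nth_le[of "ball_aut p \<delta> (f x)" i]
          by simp
        ultimately have "ereal (poincare_dist (?g i z) (?g i w)) \<le> caratheodory_dist X z w"
          by (intro caratheodory_dist_ge) auto
        also have "\<dots> < ereal (s / (3 * CARD('n)))"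
          by (rule w(2))
        finally have "poincare_dist (?g i z) (?g i w) < s / (3 * CARD('n))"
          by simp
        moreover have "?g i z = 0"
          by (simp add: ball_aut_def flip: p_def)
        ultimately have "2 * cmod (?g i w) < s / (3 * CARD('n))"
          using poincare_dist_lower[of "?g i z" "?g i w"] disc[OF X(2)] disc[OF w(1)] by simp
        then show ?thesis
          by (simp add: field_simps)
      qed
      have "norm (ball_aut p \<delta> (f w)) \<le> (\<Sum>i\<in>UNIV. cmod (?g i w))"
        unfolding norm_vec_def by (rule L2_set_le_sum) simp
      also have "\<dots> < (\<Sum>i\<in>(UNIV :: 'n set). s / 6 / CARD('n))"
        by (intro sum_strict_mono comp) auto
      finally have "norm (ball_aut p \<delta> (f w)) < s / 6"
        by simp
      then obtain y where "norm y < 1" "f w = E y"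
        using in_ellipsoid[OF p \<delta> fB[OF w(1)] s(1)] s(2) unfolding E_def by (metis less_imp_le)
      moreover from this have "h y = w"
        using f(2) w(1) by (simp add: h_def flip: \<open>f w = E y\<close>)
      ultimately show "w \<in> h ` unit_ball"
        by auto
    qed
  qed
qed

theorem corollary1p3:
  fixes X :: "(complex ^ 'n) set"
  assumes "open X" and "connected X" and "X \<noteq> {}"
    and "\<exists>c\<^sub>0>0. \<forall>z\<in>X. squeezing_fun X z > c\<^sub>0"
  shows "uniformly_thick caratheodory_dist X \<and> uniformly_thick kobayashi_dist X"
proof -
  obtain c where c: "c > 0" "\<And>z. z \<in> X \<Longrightarrow> squeezing_fun X z > c"
    using assms(4) by blast
  have tanh_bdd: "bdd_above (insert 0 {tanh (r / 2) |r. P r})" for P :: "real \<Rightarrow> bool"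
    by (rule bdd_aboveI[of _ 1]) (auto intro: less_imp_le tanh_real_lt_1)
  have squeeze: "\<exists>r f. c < r / 2 \<and> holomorphic_map f X \<and> inj_on f X \<and>
      f ` X \<subseteq> (unit_ball :: (complex ^ 'n) set) \<and> dist_ball kobayashi_dist unit_ball (f z) r \<subseteq> f ` X"
    if z: "z \<in> X" for z
  proof -
    \<comment> \<open>As \<open>c > 0\<close>, the inserted 0 cannot be the element exceeding
      \<open>c\<close>, so an actual embedding is obtained.\<close>
    obtain r and f :: "complex ^ 'n \<Rightarrow> complex ^ 'n" where "r > 0" "c < tanh (r / 2)" and f:
      "holomorphic_map f X" "inj_on f X" "f ` X \<subseteq> unit_ball"
      "dist_ball kobayashi_dist unit_ball (f z) r \<subseteq> f ` X"
      using c(2)[OF z] c(1) unfolding squeezing_fun_def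
      by (subst (asm) less_cSup_iff[OF _ tanh_bdd]) auto
    then have "c < r / 2"
      using tanh_le_self[of "r / 2"] by linarith
    with f show ?thesis
      by blast
  qed
  obtain z0 where "z0 \<in> X"
    using assms(3) by blast
  then obtain f :: "complex ^ 'n \<Rightarrow> complex ^ 'n" where
    "holomorphic_map f X" "inj_on f X" "f ` X \<subseteq> unit_ball"
    using squeeze by blast
  note hyp = hyperbolic_of_injective[OF assms(1,2) this]
  \<comment> \<open>From s at most 1/2 the density up to radius \<open>s\<close> is at most 8/3;
    then \<open>poincare_dist 0 s\<close> is at most 8 s / 3, thus at most 8 c / 9, which is below 2
    c and so below \<open>r\<close>.\<close>
  define s where "s = min (c / 3) (1 / 2)"
  have s: "0 < s" "s < 1" "s \<le> c / 3" "s \<le> 1 / 2"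
    using c(1) by (auto simp: s_def)
  define \<rho> where "\<rho> = s / (3 * CARD('n))"
  have \<rho>: "\<rho> > 0"
    using s(1) by (simp add: \<rho>_def)
  have embed: "\<exists>h :: complex ^ 'n \<Rightarrow> complex ^ 'n. holomorphic_map h unit_ball \<and> inj_on h unit_ball \<and>
      h ` unit_ball \<subseteq> X \<and> dist_ball caratheodory_dist X z \<rho> \<subseteq> h ` unit_ball"
    if z: "z \<in> X" for z
  proof -
    obtain r and f :: "complex ^ 'n \<Rightarrow> complex ^ 'n" where r: "c < r / 2" and f:
      "holomorphic_map f X" "inj_on f X" "f ` X \<subseteq> unit_ball"
      "dist_ball kobayashi_dist unit_ball (f z) r \<subseteq> f ` X"
      using squeeze[OF z] by blast
    have "s\<^sup>2 \<le> (1 / 2)\<^sup>2"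
      using s by (intro power_mono) auto
    then have "2 / (1 - s\<^sup>2) \<le> 2 / (3 / 4)"
      by (intro divide_left_mono) (auto simp: power2_eq_square)
    then have "2 / (1 - s\<^sup>2) * s \<le> 8 / 3 * s"
      using s(1) by (intro mult_right_mono) auto
    then have "poincare_dist 0 (of_real s) < r"
      using poincare_dist_upper[of s 0 "of_real s"] s r c(1) by simp
    from ball_embedding[OF assms(1) z f s(1,2) this] show ?thesis
      unfolding \<rho>_def by metis
  qed
  \<comment> \<open>A distance dominating the Caratheodory distance has smaller balls, so the same
    embedding serves both cases with the same constant.\<close>
  have fridman: "tanh (\<rho> / 2) \<le> fridman_fun d X z"
    if z: "z \<in> X" and d: "\<And>w. caratheodory_dist X z w \<le> d X z w" for d z
  proof -
    have "dist_ball d X z \<rho> \<subseteq> dist_ball caratheodory_dist X z \<rho>"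
      using le_less_trans[OF d] by (auto simp: dist_ball_def)
    moreover obtain h :: "complex ^ 'n \<Rightarrow> complex ^ 'n" where "holomorphic_map h unit_ball" "inj_on h unit_ball"
      "h ` unit_ball \<subseteq> X" "dist_ball caratheodory_dist X z \<rho> \<subseteq> h ` unit_ball"
      using embed[OF z] by blast
    ultimately have "\<exists>h :: complex ^ 'n \<Rightarrow> complex ^ 'n. holomorphic_map h unit_ball \<and> inj_on h unit_ball \<and>
        h ` unit_ball \<subseteq> X \<and> dist_ball d X z \<rho> \<subseteq> h ` unit_ball"
      by (intro exI[of _ h] conjI) (assumption | rule order_trans)+
    then show ?thesis
      unfolding fridman_fun_def using \<rho>
      by (intro cSup_upper tanh_bdd insertI2 CollectI exI[of _ \<rho>] conjI refl)
  qed
  have "tanh (\<rho> / 2) > 0"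
    using \<rho> by simp
  moreover have "\<forall>z\<in>X. tanh (\<rho> / 2) \<le> fridman_fun caratheodory_dist X z"
    by (intro ballI fridman order_refl)
  moreover have "\<forall>z\<in>X. tanh (\<rho> / 2) \<le> fridman_fun kobayashi_dist X z"
    by (intro ballI fridman caratheodory_le_kobayashi assms(1))
  ultimately show ?thesis
    unfolding uniformly_thick_def using hyp by blast
qed

end
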